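(* Let $X$ and $Y$ be Banach spaces such that: (i) $Y$ contains a complemented subspace which is isomorphic to $Y\oplus Y$; (ii) $X$ is isomorphic to $X\oplus Z$ for every complemented subspace $Z$ of $Y$; and (iii) the ideal $\{TS : S\in\mathscr{B}(X,Y),\ T\in\mathscr{B}(Y,X)\}$ of operators on $X$ that factor through $Y$ has codimension one in $\mathscr{B}(X)$. Then the mapping $$n\mapsto n[I_X]_0,\qquad \mathbb{Z}\to K_0(\mathscr{B}(X)),$$ is an isomorphism of abelian groups, where $[I_X]_0$ denotes the $K_0$-class of the identity operator $I_X$ on $X$.
   Context: All Banach spaces are over a fixed scalar field $\mathbb{K}=\mathbb{R}$ or $\mathbb{K}=\mathbb{C}$. "Operator" means bounded linear map; "isomorphic" means linearly homeomorphic; a complemented subspace is the range of a bounded idempotent operator. $\mathscr{B}(X,Y)$ is the space of operators from $X$ to $Y$, and $\mathscr{B}(X)=\mathscr{B}(X,X)$. (Under condition (i) the set in (iii) is a linear subspace, hence a two-sided ideal, of $\mathscr{B}(X)$.) $K_0$-group of a unital ring $\mathscr{A}$: let $M_{m,n}(\mathscr{A})$ be the $(m\times n)$-matrices over $\mathscr{A}$, $M_n(\mathscr{A})=M_{n,n}(\mathscr{A})$, $\operatorname{IP}_n(\mathscr{A})=\{P\in M_n(\mathscr{A}):P^2=P\}$ and $\operatorname{IP}_\infty(\mathscr{A})=\bigcup_{n\in\mathbb{N}}\operatorname{IP}_n(\mathscr{A})$. For $P\in\operatorname{IP}_m(\mathscr{A})$ and $Q\in\operatorname{IP}_n(\mathscr{A})$,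 write $P\sim_0 Q$ if $P=AB$ and $Q=BA$ for some $A\in M_{m,n}(\mathscr{A})$, $B\in M_{n,m}(\mathscr{A})$. Then $V(\mathscr{A})=\operatorname{IP}_\infty(\mathscr{A})/{\sim_0}$ is an abelian semigroup under $[P]_V+[Q]_V=\left[\begin{pmatrix}P&0\\0&Q\end{pmatrix}\right]_V$, and $K_0(\mathscr{A})$ is the Grothendieck group of $V(\mathscr{A})$; $[P]_0$ denotes the canonical image of $[P]_V$ in $K_0(\mathscr{A})$. *)

theory Defs
  imports
    "HOL-Analysis.Analysis"
    "HOL-Algebra.Algebra"
    "HOL-Library.Function_Algebras"
    "Jordan_Normal_Form.Matrix"
begin

section \<open>Banach spaces over the real or the complex field\<close>

text \<open>
  The scalar field is a type \<open>'k\<close> of class \<^class>\<open>real_normed_field\<close>. By the Gelfand--Mazur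
  theorem such a field is isometrically isomorphic, as a real algebra, to the real or to the
  complex numbers, and both types are instances of the class.

  A Banach space over \<open>'k\<close> is a type of class \<^class>\<open>banach\<close> (which provides the addition, the
  complete norm and the underlying real structure) with a scalar multiplication \<open>s\<close> by \<open>'k\<close>.
\<close>

locale banach_over = vector_space s
  for s :: "'k::real_normed_field \<Rightarrow> 'a::banach \<Rightarrow> 'a" +
  assumes norm_scale: "norm (s c x) = norm c * norm x"
    and scale_of_real: "s (of_real r) x = r *\<^sub>R x"

definition scale_prod ::
  "('k \<Rightarrow> 'a \<Rightarrow> 'a) \<Rightarrow> ('k \<Rightarrow> 'b \<Rightarrow> 'b) \<Rightarrow> 'k \<Rightarrow> 'a \<times> 'b \<Rightarrow> 'a \<times> 'b"
  where "scale_prod s t c = (\<lambda>(x, y). (s c x, t c y))"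

definition scale_fun :: "('k \<Rightarrow> 'b \<Rightarrow> 'b) \<Rightarrow> 'k \<Rightarrow> ('a \<Rightarrow> 'b) \<Rightarrow> 'a \<Rightarrow> 'b"
  where "scale_fun s c f = (\<lambda>x. s c (f x))"

definition operators ::
  "('k::real_normed_field \<Rightarrow> 'a::real_normed_vector \<Rightarrow> 'a) \<Rightarrow>
   ('k \<Rightarrow> 'b::real_normed_vector \<Rightarrow> 'b) \<Rightarrow> ('a \<Rightarrow> 'b) set"
  where "operators s t = {f. Vector_Spaces.linear s t f \<and> bounded_linear f}"

definition complemented_subspaces ::
  "('k::real_normed_field \<Rightarrow> 'a::real_normed_vector \<Rightarrow> 'a) \<Rightarrow> 'a set set"
  where "complemented_subspaces s = {range P | P. P \<in> operators s s \<and> P \<circ> P = P}"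

text \<open>
  The space with scalar multiplication \<open>s\<close> is linearly homeomorphic to the subspace \<open>W\<close> of the
  space with scalar multiplication \<open>t\<close>.
\<close>

definition isomorphic_to_subspace ::
  "('k::real_normed_field \<Rightarrow> 'a::real_normed_vector \<Rightarrow> 'a) \<Rightarrow>
   ('k \<Rightarrow> 'b::real_normed_vector \<Rightarrow> 'b) \<Rightarrow> 'b set \<Rightarrow> bool"
  where "isomorphic_to_subspace s t W \<longleftrightarrow>
    (\<exists>f g. Vector_Spaces.linear s t f \<and> homeomorphism UNIV W f g)"

definition factoring_operators ::
  "('k::real_normed_field \<Rightarrow> 'a::real_normed_vector \<Rightarrow> 'a) \<Rightarrow>
   ('k \<Rightarrow> 'b::real_normed_vector \<Rightarrow> 'b) \<Rightarrow> ('a \<Rightarrow> 'a) set"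
  where "factoring_operators s t = {T \<circ> S | S T. S \<in> operators s t \<and> T \<in> operators t s}"

text \<open>
  The quotient \<open>V / J\<close> of a vector space \<open>V\<close> by a subspace \<open>J\<close> has dimension \<open>n\<close>: modulo \<open>J\<close>,
  every vector of \<open>V\<close> is a linear combination, with unique coefficients \<open>a\<close>, of the \<open>n\<close> elements
  of \<open>B\<close>. (Uniqueness forces distinct elements of \<open>B\<close> to have distinct cosets.)
\<close>

definition has_codimension ::
  "('k::field \<Rightarrow> 'v::ab_group_add \<Rightarrow> 'v) \<Rightarrow> 'v set \<Rightarrow> 'v set \<Rightarrow> nat \<Rightarrow> bool"
  where "has_codimension s J V n \<longleftrightarrow>
    (\<exists>B \<subseteq> V. finite B \<and> card B = n \<and>
      (\<forall>v\<in>V. \<exists>!a. (\<forall>b. b \<notin> B \<longrightarrow> a b = 0) \<and> v - (\<Sum>b\<in>B. s (a b) b) \<in> J))"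

definition operator_ring ::
  "('k::real_normed_field \<Rightarrow> 'a::real_normed_vector \<Rightarrow> 'a) \<Rightarrow> ('a \<Rightarrow> 'a) ring"
  where "operator_ring s =
    \<lparr>carrier = operators s s, monoid.mult = (\<lambda>f g. f \<circ> g), one = id,
     ring.zero = (\<lambda>x. 0), add = (\<lambda>f g x. f x + g x)\<rparr>"

section \<open>The Grothendieck group of an abelian semigroup\<close>

text \<open>
  The semigroup is given by its carrier \<open>S\<close> and its addition \<open>p\<close>; it need not have a neutral
  element, whence the definitions of the neutral element and of the canonical map.
  The group is written multiplicatively, as always in \<^theory>\<open>HOL-Algebra.Group\<close>.
\<close>

definition grothendieck_rel ::
  "'a set \<Rightarrow> ('a \<Rightarrow> 'a \<Rightarrow> 'a) \<Rightarrow> (('a \<times> 'a) \<times> ('a \<times> 'a)) set"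
  where "grothendieck_rel S p =
    {((a, b), (c, d)). a \<in> S \<and> b \<in> S \<and> c \<in> S \<and> d \<in> S \<and>
      (\<exists>e\<in>S. p (p a d) e = p (p c b) e)}"

definition grothendieck_group :: "'a set \<Rightarrow> ('a \<Rightarrow> 'a \<Rightarrow> 'a) \<Rightarrow> ('a \<times> 'a) set monoid"
  where "grothendieck_group S p =
    \<lparr>carrier = (S \<times> S) // grothendieck_rel S p,
     monoid.mult = (\<lambda>U W. \<Union>(a, b)\<in>U. \<Union>(c, d)\<in>W. grothendieck_rel S p `` {(p a c, p b d)}),
     one = (\<Union>s\<in>S. grothendieck_rel S p `` {(s, s)})\<rparr>"

definition grothendieck_map :: "'a set \<Rightarrow> ('a \<Rightarrow> 'a \<Rightarrow> 'a) \<Rightarrow> 'a \<Rightarrow> ('a \<times> 'a) set"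
  where "grothendieck_map S p x = grothendieck_rel S p `` {(p x x, x)}"

section \<open>The group \<open>K\<^sub>0\<close> of a unital ring\<close>

text \<open>
  The type \<^typ>\<open>'a mat\<close> only serves as a container of entries with dimensions; its own algebraic
  operations refer to type classes, so those over a ring \<open>R\<close> with carrier are given here.
\<close>

definition mats :: "('a, 'b) ring_scheme \<Rightarrow> nat \<Rightarrow> nat \<Rightarrow> 'a mat set"
  where "mats R m n = {A \<in> carrier_mat m n. \<forall>i<m. \<forall>j<n. A $$ (i, j) \<in> carrier R}"

definition mat_mult :: "('a, 'b) ring_scheme \<Rightarrow> 'a mat \<Rightarrow> 'a mat \<Rightarrow> 'a mat"
  where "mat_mult R A B =
    mat (dim_row A) (dim_col B)
      (\<lambda>(i, j). \<Oplus>\<^bsub>R\<^esub>k\<in>{..<dim_col A}. A $$ (i, k) \<otimes>\<^bsub>R\<^esub> B $$ (k, j))"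

definition mat_dsum :: "('a, 'b) ring_scheme \<Rightarrow> 'a mat \<Rightarrow> 'a mat \<Rightarrow> 'a mat"
  where "mat_dsum R P Q =
    four_block_mat P (mat (dim_row P) (dim_col Q) (\<lambda>_. \<zero>\<^bsub>R\<^esub>))
      (mat (dim_row Q) (dim_col P) (\<lambda>_. \<zero>\<^bsub>R\<^esub>)) Q"

definition IP :: "('a, 'b) ring_scheme \<Rightarrow> nat \<Rightarrow> 'a mat set"
  where "IP R n = {P \<in> mats R n n. mat_mult R P P = P}"

definition IP_inf :: "('a, 'b) ring_scheme \<Rightarrow> 'a mat set"
  where "IP_inf R = (\<Union>n\<in>{1..}. IP R n)"

definition sim0 :: "('a, 'b) ring_scheme \<Rightarrow> ('a mat \<times> 'a mat) set"
  where "sim0 R =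
    {(P, Q). \<exists>m\<ge>1. \<exists>n\<ge>1. P \<in> IP R m \<and> Q \<in> IP R n \<and>
      (\<exists>A\<in>mats R m n. \<exists>B\<in>mats R n m. P = mat_mult R A B \<and> Q = mat_mult R B A)}"

definition V_carrier :: "('a, 'b) ring_scheme \<Rightarrow> 'a mat set set"
  where "V_carrier R = IP_inf R // sim0 R"

definition V_class :: "('a, 'b) ring_scheme \<Rightarrow> 'a mat \<Rightarrow> 'a mat set"
  where "V_class R P = sim0 R `` {P}"

definition V_add :: "('a, 'b) ring_scheme \<Rightarrow> 'a mat set \<Rightarrow> 'a mat set \<Rightarrow> 'a mat set"
  where "V_add R U W = (\<Union>P\<in>U. \<Union>Q\<in>W. V_class R (mat_dsum R P Q))"

definition K0 :: "('a, 'b) ring_scheme \<Rightarrow> ('a mat set \<times> 'a mat set) set monoid"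
  where "K0 R = grothendieck_group (V_carrier R) (V_add R)"

definition K0_class :: "('a, 'b) ring_scheme \<Rightarrow> 'a mat \<Rightarrow> ('a mat set \<times> 'a mat set) set"
  where "K0_class R P = grothendieck_map (V_carrier R) (V_add R) (V_class R P)"

text \<open>A ring element, regarded as a matrix with one row and one column.\<close>

definition mat_single :: "'a \<Rightarrow> 'a mat"
  where "mat_single r = mat 1 1 (\<lambda>_. r)"

end

theory Submission
  imports Defs
begin

text \<open>
  By (ii) with \<open>Z = Y\<close>, the space \<open>Y\<close> is complemented in \<open>X\<close>, so the ideal in (iii) is generated by an
  idempotent \<open>e\<close> of \<open>R = B(X)\<close> with range isomorphic to \<open>Y\<close>. Condition (i) says that matrices over
  the ideal factor through \<open>e\<close> itself, and (ii) says that \<open>[f] + [1] = [1]\<close> in \<open>V(R)\<close> for every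
  idempotent \<open>f \<le> e\<close>. Let \<open>P\<close> be an idempotent matrix over \<open>R\<close>. Modulo the ideal it is an idempotent
  scalar matrix, of rank \<open>k\<close> say, so \<open>P - A B\<close> lies in the ideal for scalar matrices with
  \<open>B A = 1\<^sub>k\<close>. Hence the identity of the range of \<open>P\<close> factors through \<open>1\<^sub>k \<oplus> e\<close>, and the
  complementary idempotent \<open>G\<close> has entries in the ideal, so that \<open>[P] + [G] = [1\<^sub>k] + [e]\<close>
  and \<open>G\<close> is equivalent to some \<open>f \<le> e\<close>. Adding \<open>[1]\<close> absorbs \<open>[G]\<close> and \<open>[e]\<close>; thus
  \<open>[P] + [1] = (k + 1) [1]\<close>, which gives surjectivity. The trace of the scalar part is additive on
  \<open>V(R)\<close> and equals \<open>1\<close> at \<open>[1]\<close>, which gives injectivity.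
\<close>

section \<open>Grothendieck groups\<close>

text \<open>The semigroup V(R) lacks cancellation, and idempotent matrices that agree modulo the
  ideal need not be equivalent, so [P] cannot be read off from its scalar part. The copy of e
  adjoined to 1_k provides the room that carries the discrepancy P - A B, and it does no harm
  because [1] absorbs it. The complement G is the price of this embedding. It is under control
  because B A = 1_k holds exactly and not just modulo the ideal: thus 1_k - B P A = B (A B - P) A is
  again an ideal matrix. Exact lifts exist because codimension one makes the quotient of B(X) by the
  ideal the scalar field, and the multiples of the identity split this quotient. For injectivity, an
  equality in the Grothendieck group is an equality in V(R) up to an unknown summand; an additive
  invariant with values in a field of characteristic zero ignores that summand and separates the
  multiples of [1].\<close>

locale abelian_semigroup =
  fixes S :: "'a set" and p :: "'a \<Rightarrow> 'a \<Rightarrow> 'a" (infixl \<open>\<oplus>\<^sub>S\<close> 65)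
  assumes closed [simp, intro]: "x \<in> S \<Longrightarrow> y \<in> S \<Longrightarrow> x \<oplus>\<^sub>S y \<in> S"
    and assoc: "x \<in> S \<Longrightarrow> y \<in> S \<Longrightarrow> z \<in> S \<Longrightarrow> (x \<oplus>\<^sub>S y) \<oplus>\<^sub>S z = x \<oplus>\<^sub>S (y \<oplus>\<^sub>S z)"
    and commute: "x \<in> S \<Longrightarrow> y \<in> S \<Longrightarrow> x \<oplus>\<^sub>S y = y \<oplus>\<^sub>S x"
begin

lemma left_commute:
  "x \<in> S \<Longrightarrow> y \<in> S \<Longrightarrow> z \<in> S \<Longrightarrow> x \<oplus>\<^sub>S (y \<oplus>\<^sub>S z) = y \<oplus>\<^sub>S (x \<oplus>\<^sub>S z)"
  by (metis assoc commute)

lemmas ac = assoc commute left_commute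

abbreviation rel where "rel \<equiv> grothendieck_rel S p"
abbreviation G where "G \<equiv> grothendieck_group S p"
abbreviation cls where "cls a b \<equiv> rel `` {(a, b)}"

lemma rel_iff:
  "((a, b), (c, d)) \<in> rel \<longleftrightarrow> a \<in> S \<and> b \<in> S \<and> c \<in> S \<and> d \<in> S \<and>
      (\<exists>e\<in>S. (a \<oplus>\<^sub>S d) \<oplus>\<^sub>S e = (c \<oplus>\<^sub>S b) \<oplus>\<^sub>S e)"
  by (simp add: grothendieck_rel_def)

lemma relI:
  assumes "a \<in> S" "b \<in> S" "c \<in> S" "d \<in> S" "a \<oplus>\<^sub>S d = c \<oplus>\<^sub>S b"
  shows "((a, b), (c, d)) \<in> rel"
  using assms by (auto simp: rel_iff)

lemma equiv_rel: "equiv (S \<times> S) rel"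
proof (rule equivI)
  show "rel \<subseteq> (S \<times> S) \<times> S \<times> S"
    by (auto simp: grothendieck_rel_def)
  show "refl_on (S \<times> S) rel"
    by (rule refl_onI) (auto simp: rel_iff)
  show "sym rel"
    by (rule symI) (auto simp: rel_iff, metis)
  show "trans rel"
  proof (rule transI, clarify)
    fix a b c d x y assume "((a, b), (c, d)) \<in> rel" "((c, d), (x, y)) \<in> rel"
    then obtain e f where S: "a \<in> S" "b \<in> S" "c \<in> S" "d \<in> S" "x \<in> S" "y \<in> S" "e \<in> S" "f \<in> S"
      and 1: "(a \<oplus>\<^sub>S d) \<oplus>\<^sub>S e = (c \<oplus>\<^sub>S b) \<oplus>\<^sub>S e" and 2: "(c \<oplus>\<^sub>S y) \<oplus>\<^sub>S f = (x \<oplus>\<^sub>S d) \<oplus>\<^sub>S f"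
      by (auto simp: rel_iff)
    \<comment> \<open>Without cancellation the middle term \<open>d\<close> cannot be dropped, so it
      joins \<open>e\<close> and \<open>f\<close> in the witness.\<close>
    have "(a \<oplus>\<^sub>S y) \<oplus>\<^sub>S (d \<oplus>\<^sub>S e \<oplus>\<^sub>S f) = ((a \<oplus>\<^sub>S d) \<oplus>\<^sub>S e) \<oplus>\<^sub>S (y \<oplus>\<^sub>S f)"
      using S by (simp add: ac)
    also have "\<dots> = ((c \<oplus>\<^sub>S y) \<oplus>\<^sub>S f) \<oplus>\<^sub>S (b \<oplus>\<^sub>S e)"
      unfolding 1 using S by (simp add: ac)
    also have "\<dots> = (x \<oplus>\<^sub>S b) \<oplus>\<^sub>S (d \<oplus>\<^sub>S e \<oplus>\<^sub>S f)"
      unfolding 2 using S by (simp add: ac)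
    finally have "(a \<oplus>\<^sub>S y) \<oplus>\<^sub>S (d \<oplus>\<^sub>S e \<oplus>\<^sub>S f) = (x \<oplus>\<^sub>S b) \<oplus>\<^sub>S (d \<oplus>\<^sub>S e \<oplus>\<^sub>S f)" .
    moreover have "d \<oplus>\<^sub>S e \<oplus>\<^sub>S f \<in> S" using S by simp
    ultimately show "((a, b), (x, y)) \<in> rel" using S by (auto simp: rel_iff)
  qed
qed

lemma cls_eq_iff:
  assumes "a \<in> S" "b \<in> S" "c \<in> S" "d \<in> S"
  shows "cls a b = cls c d \<longleftrightarrow> ((a, b), (c, d)) \<in> rel"
  using eq_equiv_class_iff[OF equiv_rel] assms by simp

lemma cls_in_carrier: "a \<in> S \<Longrightarrow> b \<in> S \<Longrightarrow> cls a b \<in> carrier G"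
  by (auto simp: grothendieck_group_def intro!: quotientI)

lemma carrierE:
  assumes "U \<in> carrier G" obtains a b where "a \<in> S" "b \<in> S" "U = cls a b"
  using assms by (auto simp: grothendieck_group_def elim!: quotientE)

lemma mult_cls:
  \<comment> \<open>The product is a union over all pairs of representatives. Each pair yields the
    same class, so the nonempty union collapses to it.\<close>
  assumes "a \<in> S" "b \<in> S" "c \<in> S" "d \<in> S"
  shows "cls a b \<otimes>\<^bsub>G\<^esub> cls c d = cls (a \<oplus>\<^sub>S c) (b \<oplus>\<^sub>S d)"
proof -
  have "cls (a' \<oplus>\<^sub>S c') (b' \<oplus>\<^sub>S d') = cls (a \<oplus>\<^sub>S c) (b \<oplus>\<^sub>S d)"
    if r: "((a, b), (a', b')) \<in> rel" "((c, d), (c', d')) \<in> rel" for a' b' c' d'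
  proof -
    obtain e f where S: "a' \<in> S" "b' \<in> S" "c' \<in> S" "d' \<in> S" "e \<in> S" "f \<in> S"
      and 1: "(a \<oplus>\<^sub>S b') \<oplus>\<^sub>S e = (a' \<oplus>\<^sub>S b) \<oplus>\<^sub>S e" and 2: "(c \<oplus>\<^sub>S d') \<oplus>\<^sub>S f = (c' \<oplus>\<^sub>S d) \<oplus>\<^sub>S f"
      using r by (auto simp: rel_iff)
    have "((a \<oplus>\<^sub>S c) \<oplus>\<^sub>S (b' \<oplus>\<^sub>S d')) \<oplus>\<^sub>S (e \<oplus>\<^sub>S f) = ((a \<oplus>\<^sub>S b') \<oplus>\<^sub>S e) \<oplus>\<^sub>S ((c \<oplus>\<^sub>S d') \<oplus>\<^sub>S f)"
      using S assms by (simp add: ac)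
    also have "\<dots> = ((a' \<oplus>\<^sub>S c') \<oplus>\<^sub>S (b \<oplus>\<^sub>S d)) \<oplus>\<^sub>S (e \<oplus>\<^sub>S f)"
      unfolding 1 2 using S assms by (simp add: ac)
    finally have "((a \<oplus>\<^sub>S c, b \<oplus>\<^sub>S d), (a' \<oplus>\<^sub>S c', b' \<oplus>\<^sub>S d')) \<in> rel"
      using S assms by (auto simp: rel_iff)
    then show ?thesis using S assms by (metis cls_eq_iff closed)
  qed
  then have "(\<Union>(a', b')\<in>cls a b. \<Union>(c', d')\<in>cls c d. cls (a' \<oplus>\<^sub>S c') (b' \<oplus>\<^sub>S d')) =
      (\<Union>(a', b')\<in>cls a b. \<Union>(c', d')\<in>cls c d. cls (a \<oplus>\<^sub>S c) (b \<oplus>\<^sub>S d))"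
    by (intro SUP_cong refl) (auto simp: split_beta)
  also have "\<dots> = cls (a \<oplus>\<^sub>S c) (b \<oplus>\<^sub>S d)"
  proof -
    have "(a, b) \<in> cls a b" "(c, d) \<in> cls c d"
      using assms by (auto intro: relI)
    then show ?thesis by auto
  qed
  finally show ?thesis by (simp add: grothendieck_group_def)
qed

lemma one_cls: "s \<in> S \<Longrightarrow> \<one>\<^bsub>G\<^esub> = cls s s"
proof -
  assume s: "s \<in> S"
  have "cls t t = cls s s" if "t \<in> S" for t
    using that s by (subst cls_eq_iff) (auto intro!: relI simp: ac)
  then have "(\<Union>t\<in>S. cls t t) = (\<Union>t\<in>S. cls s s)" by (intro SUP_cong) auto
  then show ?thesis using s by (auto simp: grothendieck_group_def)
qed

lemma group_G:
  assumes "S \<noteq> {}"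
  shows "group G"
proof (rule groupI)
  obtain s where s: "s \<in> S" using assms by auto
  show "\<one>\<^bsub>G\<^esub> \<in> carrier G" using s by (simp add: one_cls[of s] cls_in_carrier)
  fix x y z assume "x \<in> carrier G" "y \<in> carrier G" "z \<in> carrier G"
  then obtain a b c d e f where S: "a \<in> S" "b \<in> S" "c \<in> S" "d \<in> S" "e \<in> S" "f \<in> S"
    and eq: "x = cls a b" "y = cls c d" "z = cls e f"
    by (metis carrierE)
  show "x \<otimes>\<^bsub>G\<^esub> y \<in> carrier G" using S by (simp add: eq mult_cls cls_in_carrier)
  show "x \<otimes>\<^bsub>G\<^esub> y \<otimes>\<^bsub>G\<^esub> z = x \<otimes>\<^bsub>G\<^esub> (y \<otimes>\<^bsub>G\<^esub> z)" using S by (simp add: eq mult_cls ac)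
  show "\<one>\<^bsub>G\<^esub> \<otimes>\<^bsub>G\<^esub> x = x"
    using S s by (simp add: eq one_cls[of s] mult_cls, subst cls_eq_iff)
      (auto intro!: relI simp: ac)
  have "cls b a \<otimes>\<^bsub>G\<^esub> x = \<one>\<^bsub>G\<^esub>"
    using S by (simp add: eq one_cls[of "a \<oplus>\<^sub>S b"] mult_cls ac)
  then show "\<exists>y\<in>carrier G. y \<otimes>\<^bsub>G\<^esub> x = \<one>\<^bsub>G\<^esub>"
    using S by (auto intro: cls_in_carrier)
qed

abbreviation g where "g \<equiv> grothendieck_map S p"

lemma g_in_carrier: "x \<in> S \<Longrightarrow> g x \<in> carrier G"
  by (simp add: grothendieck_map_def cls_in_carrier)

lemma g_add: "x \<in> S \<Longrightarrow> y \<in> S \<Longrightarrow> g (x \<oplus>\<^sub>S y) = g x \<otimes>\<^bsub>G\<^esub> g y"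
  by (simp add: grothendieck_map_def mult_cls ac)

lemma cls_mult_g: "a \<in> S \<Longrightarrow> b \<in> S \<Longrightarrow> cls a b \<otimes>\<^bsub>G\<^esub> g b = g a"
  by (simp add: grothendieck_map_def mult_cls, subst cls_eq_iff) (auto intro!: relI simp: ac)

lemma g_eqD:
  assumes "x \<in> S" "y \<in> S" "g x = g y"
  obtains e where "e \<in> S" "x \<oplus>\<^sub>S e = y \<oplus>\<^sub>S e"
proof -
  have "((x \<oplus>\<^sub>S x, x), (y \<oplus>\<^sub>S y, y)) \<in> rel"
    using assms unfolding grothendieck_map_def by (subst (asm) cls_eq_iff) auto
  then obtain e where e: "e \<in> S" "(x \<oplus>\<^sub>S x \<oplus>\<^sub>S y) \<oplus>\<^sub>S e = (y \<oplus>\<^sub>S y \<oplus>\<^sub>S x) \<oplus>\<^sub>S e"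
    by (auto simp: rel_iff)
  show ?thesis
  proof (rule that)
    show "x \<oplus>\<^sub>S y \<oplus>\<^sub>S e \<in> S" using assms e by simp
    show "x \<oplus>\<^sub>S (x \<oplus>\<^sub>S y \<oplus>\<^sub>S e) = y \<oplus>\<^sub>S (x \<oplus>\<^sub>S y \<oplus>\<^sub>S e)"
      using e assms by (simp add: ac)
  qed
qed

text \<open>The iterate \<open>((\<oplus>\<^sub>S) u ^^ n) u\<close> is the (n+1)-fold sum of
  \<open>u\<close>: a neutral element may be missing, so the iteration starts at
  \<open>u\<close>.\<close>

lemma pow_in_S: "u \<in> S \<Longrightarrow> ((\<oplus>\<^sub>S) u ^^ n) u \<in> S"
  by (induction n) auto

lemma g_pow:
  assumes "u \<in> S" shows "g (((\<oplus>\<^sub>S) u ^^ n) u) = g u [^]\<^bsub>G\<^esub> Suc n"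
proof -
  interpret group G using assms by (intro group_G) auto
  show ?thesis
  proof (induction n)
    case (Suc n)
    have "g (((\<oplus>\<^sub>S) u ^^ Suc n) u) = g u \<otimes>\<^bsub>G\<^esub> g u [^]\<^bsub>G\<^esub> Suc n"
      using assms by (simp only: funpow.simps o_apply g_add pow_in_S Suc.IH)
    then show ?case using g_in_carrier[OF assms] by (metis nat_pow_Suc2)
  qed (use assms g_in_carrier in simp)
qed

text \<open>Surjectivity only needs every class to become a multiple of \<open>u\<close> after adding \<open>u\<close>, since
  \<open>u\<close> can be cancelled in the Grothendieck group; injectivity is detected by the additive map \<open>t\<close>.\<close>

lemma int_iso_G:
  fixes t :: "'a \<Rightarrow> 'k::ring_char_0"
  assumes u: "u \<in> S"
    and gen: "\<And>x. x \<in> S \<Longrightarrow> \<exists>n. x \<oplus>\<^sub>S u = ((\<oplus>\<^sub>S) u ^^ n) u"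
    and t_add: "\<And>x y. x \<in> S \<Longrightarrow> y \<in> S \<Longrightarrow> t (x \<oplus>\<^sub>S y) = t x + t y"
    and t_u: "t u = 1"
  shows "(\<lambda>n::int. g u [^]\<^bsub>G\<^esub> n) \<in> iso integer_group G"
proof -
  interpret group G using u by (intro group_G) auto
  note gu = g_in_carrier[OF u]
  have hom: "(\<lambda>n::int. g u [^]\<^bsub>G\<^esub> n) \<in> hom integer_group G"
    using gu by (auto simp: hom_def integer_group_def int_pow_mult)
  have t_pow: "t (((\<oplus>\<^sub>S) u ^^ n) u) = of_nat (Suc n)" for n
    by (induction n) (use u in \<open>simp_all add: t_add t_u pow_in_S\<close>)
  have no_torsion: "g u [^]\<^bsub>G\<^esub> Suc n \<noteq> \<one>\<^bsub>G\<^esub>" for n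
  proof
    let ?x = "((\<oplus>\<^sub>S) u ^^ n) u"
    assume "g u [^]\<^bsub>G\<^esub> Suc n = \<one>\<^bsub>G\<^esub>"
    then have "g (?x \<oplus>\<^sub>S u) = g u"
      using u gu by (simp add: g_add g_pow pow_in_S del: nat_pow_Suc)
    then obtain e where "e \<in> S" "?x \<oplus>\<^sub>S u \<oplus>\<^sub>S e = u \<oplus>\<^sub>S e"
      using u pow_in_S by (metis g_eqD closed)
    \<comment> \<open>Values of \<open>t\<close> can be cancelled, unlike elements of the semigroup.
      The value is also n + 1, which is nonzero in characteristic zero.\<close>
    then have "t ?x = 0"
      using u pow_in_S[OF u, of n] t_add[of "?x \<oplus>\<^sub>S u" e] t_add[of ?x u] t_add[of u e] by simp
    then show False using t_pow by (metis of_nat_eq_0_iff nat.simps(3))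
  qed
  have inj: "n = 0" if "g u [^]\<^bsub>G\<^esub> n = \<one>\<^bsub>G\<^esub>" for n :: int
  proof (rule ccontr)
    assume "n \<noteq> 0"
    then have "nat \<bar>n\<bar> \<noteq> 0" by simp
    then obtain m where m: "nat \<bar>n\<bar> = Suc m" by (metis not0_implies_Suc)
    have "g u [^]\<^bsub>G\<^esub> (int (Suc m)) = \<one>\<^bsub>G\<^esub>"
    proof (cases "n > 0")
      case True then show ?thesis using m that by (metis abs_of_pos int_nat_eq order_less_imp_le)
    next
      case False
      then have "n = - int (Suc m)" using m by linarith
      then show ?thesis using that gu by (metis int_pow_neg inv_eq_1_iff int_pow_closed)
    qed
    then show False using no_torsion by (metis int_pow_int)
  qed
  have surj: "\<exists>n::int. y = g u [^]\<^bsub>G\<^esub> n" if y: "y \<in> carrier G" for y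
  proof -
    have gx: "\<exists>n::int. g x = g u [^]\<^bsub>G\<^esub> n" if x: "x \<in> S" for x
    proof -
      obtain n where "x \<oplus>\<^sub>S u = ((\<oplus>\<^sub>S) u ^^ n) u" using gen[OF x] by auto
      then have "g x \<otimes>\<^bsub>G\<^esub> g u = g u [^]\<^bsub>G\<^esub> n \<otimes>\<^bsub>G\<^esub> g u"
        using u x by (metis g_add g_pow nat_pow_Suc)
      \<comment> \<open>The iterate has n + 1 summands; cancelling the added \<open>u\<close> leaves
        the exponent n.\<close>
      then have "g x = g u [^]\<^bsub>G\<^esub> int n"
        using gu g_in_carrier[OF x] by (simp add: int_pow_int)
      then show ?thesis by blast
    qed
    obtain a b where ab: "a \<in> S" "b \<in> S" "y = cls a b" using y by (rule carrierE)
    obtain m n :: int where mn: "g a = g u [^]\<^bsub>G\<^esub> m" "g b = g u [^]\<^bsub>G\<^esub> n" using gx ab by metis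
    have "y \<otimes>\<^bsub>G\<^esub> g u [^]\<^bsub>G\<^esub> n = g u [^]\<^bsub>G\<^esub> (m - n) \<otimes>\<^bsub>G\<^esub> g u [^]\<^bsub>G\<^esub> n"
      using cls_mult_g[of a b] ab mn gu by (simp add: int_pow_mult[symmetric])
    then have "y = g u [^]\<^bsub>G\<^esub> (m - n)" using y gu by simp
    then show ?thesis by blast
  qed
  have "inj (\<lambda>n::int. g u [^]\<^bsub>G\<^esub> n)"
  proof (rule injI)
    fix m n :: int assume "g u [^]\<^bsub>G\<^esub> m = g u [^]\<^bsub>G\<^esub> n"
    then have "g u [^]\<^bsub>G\<^esub> (m - n) = \<one>\<^bsub>G\<^esub>" using gu by (simp add: int_pow_diff)
    then show "m = n" using inj by fastforce
  qed
  then show ?thesis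
    using hom surj gu by (auto simp: iso_def bij_betw_def integer_group_def)
qed

end

section \<open>Equivalence of idempotents\<close>

text \<open>Modelled on the infinite matrices with finitely many nonzero entries, which have no
  identity among them.\<close>

locale nonunital_subring =
  fixes M :: "'e::ring set"
  assumes zero_closed [simp, intro]: "0 \<in> M"
    and add_closed [simp, intro]: "x \<in> M \<Longrightarrow> y \<in> M \<Longrightarrow> x + y \<in> M"
    and uminus_closed [simp, intro]: "x \<in> M \<Longrightarrow> - x \<in> M"
    and mult_closed [simp, intro]: "x \<in> M \<Longrightarrow> y \<in> M \<Longrightarrow> x * y \<in> M"
begin

lemma diff_closed [simp, intro]: "x \<in> M \<Longrightarrow> y \<in> M \<Longrightarrow> x - y \<in> M"
  using add_closed[of x "- y"] by simp

definition idem :: "'e set" where "idem = {p \<in> M. p * p = p}"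

lemma idemI: "p \<in> M \<Longrightarrow> p * p = p \<Longrightarrow> p \<in> idem"
  by (simp add: idem_def)

lemma idem_in_M [simp]: "p \<in> idem \<Longrightarrow> p \<in> M"
  and idem_idem [simp]: "p \<in> idem \<Longrightarrow> p * p = p"
  by (auto simp: idem_def)

lemma idem_left [simp]: "p \<in> idem \<Longrightarrow> p * (p * x) = p * x"
  by (metis idem_idem mult.assoc)

lemma idem_add:
  "p \<in> idem \<Longrightarrow> q \<in> idem \<Longrightarrow> p * q = 0 \<Longrightarrow> q * p = 0 \<Longrightarrow> p + q \<in> idem"
  by (rule idemI) (simp_all add: algebra_simps)

text \<open>Algebraic Murray-von Neumann equivalence. Matrix sizes have disappeared because both
  idempotents lie in one ring.\<close>

definition eqv :: "'e \<Rightarrow> 'e \<Rightarrow> bool" (infix \<open>\<asymp>\<close> 50)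
  where "p \<asymp> q \<longleftrightarrow> p \<in> idem \<and> q \<in> idem \<and> (\<exists>a\<in>M. \<exists>b\<in>M. p = a * b \<and> q = b * a)"

lemma eqvI:
  "p \<in> idem \<Longrightarrow> q \<in> idem \<Longrightarrow> a \<in> M \<Longrightarrow> b \<in> M \<Longrightarrow> p = a * b \<Longrightarrow> q = b * a \<Longrightarrow> p \<asymp> q"
  by (auto simp: eqv_def)

lemma eqv_idem: assumes "p \<asymp> q" shows "p \<in> idem" "q \<in> idem"
  using assms by (auto simp: eqv_def)

lemma eqv_refl [simp]: "p \<in> idem \<Longrightarrow> p \<asymp> p"
  by (rule eqvI[of _ _ p p]) auto

lemma eqv_sym: "p \<asymp> q \<Longrightarrow> q \<asymp> p"
  by (auto simp: eqv_def)

text \<open>The factors can be replaced by \<open>p * a * q\<close> and \<open>q * b * p\<close>.\<close>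

lemma eqvE:
  assumes "p \<asymp> q"
  obtains a b where "a \<in> M" "b \<in> M" "p = a * b" "q = b * a"
    "p * a = a" "a * q = a" "q * b = b" "b * p = b"
proof -
  from assms obtain a b where ab: "p \<in> idem" "q \<in> idem" "a \<in> M" "b \<in> M"
    and p: "p = a * b" and q: "q = b * a"
    by (auto simp: eqv_def)
  have pp: "p * p = p" and qq: "q * q = q"
    using ab by simp_all
  have "p * a * q * (q * b * p) = p * (a * (q * q * b) * p)"
    by (simp only: mult.assoc)
  also have "\<dots> = p * (a * b * (a * b) * p)"
    unfolding qq by (simp only: q mult.assoc)
  finally have 1: "p * a * q * (q * b * p) = p"
    unfolding p[symmetric] pp .
  have "q * b * p * (p * a * q) = q * (b * (p * p * a) * q)"
    by (simp only: mult.assoc)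
  also have "\<dots> = q * (b * a * (b * a) * q)"
    unfolding pp by (simp only: p mult.assoc)
  finally have 2: "q * b * p * (p * a * q) = q"
    unfolding q[symmetric] qq .
  show ?thesis
  proof (rule that)
    show "p * a * q \<in> M" "q * b * p \<in> M" using ab by simp_all
    show "p * (p * a * q) = p * a * q" "p * a * q * q = p * a * q"
      "q * (q * b * p) = q * b * p" "q * b * p * p = q * b * p"
      by (simp_all add: ab(1,2) mult.assoc pp qq)
  qed (simp_all only: 1 2)
qed

text \<open>With normalised factors the middle idempotent acts as an identity: a c d b = a q b = a
  b, and likewise on the other side.\<close>

lemma eqv_trans [trans]:
  assumes "p \<asymp> q" "q \<asymp> r" shows "p \<asymp> r"
proof -
  obtain a b where ab: "a \<in> M" "b \<in> M" "p = a * b" "q = b * a"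
    "p * a = a" "a * q = a" "q * b = b" "b * p = b"
    using assms(1) by (rule eqvE)
  obtain c d where cd: "c \<in> M" "d \<in> M" "q = c * d" "r = d * c"
    "q * c = c" "c * r = c" "r * d = d" "d * q = d"
    using assms(2) by (rule eqvE)
  have "a * c * (d * b) = a * (c * d) * b" "d * b * (a * c) = d * (b * a) * c"
    by (simp_all only: mult.assoc)
  then have "p = a * c * (d * b)" "r = d * b * (a * c)"
    unfolding ab(4)[symmetric] cd(3)[symmetric] ab(6) cd(8) ab(3) cd(4) by simp_all
  then show ?thesis
    using ab(1,2) cd(1,2) eqv_idem(1)[OF assms(1)] eqv_idem(2)[OF assms(2)]
    by (intro eqvI[of p r "a * c" "d * b"]) simp_all
qed

text \<open>Normalised factors carry their idempotents on both sides, so orthogonality kills the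
  mixed products and the factors may simply be added.\<close>

lemma eqv_add:
  assumes "p \<asymp> p'" "q \<asymp> q'" "p * q = 0" "q * p = 0" "p' * q' = 0" "q' * p' = 0"
  shows "p + q \<asymp> p' + q'"
proof -
  obtain a b where ab: "a \<in> M" "b \<in> M" "p = a * b" "p' = b * a"
    "p * a = a" "a * p' = a" "p' * b = b" "b * p = b"
    using assms(1) by (rule eqvE)
  obtain c d where cd: "c \<in> M" "d \<in> M" "q = c * d" "q' = d * c"
    "q * c = c" "c * q' = c" "q' * d = d" "d * q = d"
    using assms(2) by (rule eqvE)
  have "a * p' * (q' * d) = a * (p' * q') * d" "c * q' * (p' * b) = c * (q' * p') * b"
    "d * q * (p * a) = d * (q * p) * a" "b * p * (q * c) = b * (p * q) * c"
    by (simp_all only: mult.assoc)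
  then have 0: "a * d = 0" "c * b = 0" "d * a = 0" "b * c = 0"
    by (simp_all only: ab(5-8) cd(5-8) assms(3-6) mult_zero_left mult_zero_right)
  show ?thesis
  proof (rule eqvI[of _ _ "a + c" "b + d"])
    show "p + q = (a + c) * (b + d)" "p' + q' = (b + d) * (a + c)"
      using ab(3,4) cd(3,4) 0 by (simp_all add: algebra_simps)
  qed (use assms ab(1,2) cd(1,2) in \<open>auto intro: idem_add dest: eqv_idem\<close>)
qed

text \<open>Since G U e V G = G, the elements G U e and e V G have product G, and their product in
  the other order is an idempotent below \<open>e\<close>.\<close>

lemma eqv_below:
  assumes "G \<in> idem" "e \<in> idem" "U \<in> M" "V \<in> M" "G = U * e * V"
  obtains f where "f \<in> idem" "e * f = f" "f * e = f" "G \<asymp> f"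
proof
  let ?f = "e * V * G * (U * e)"
  have "G * (U * e * V) * G = G"
    using assms(1) by (simp only: assms(5)[symmetric] idem_idem)
  then have GG: "G * (U * (e * (V * (G * x)))) = G * x" "G * (U * (e * (V * G))) = G" for x
    by (metis mult.assoc)+
  show f: "?f \<in> idem"
    using assms(1-4) by (intro idemI) (simp_all add: mult.assoc GG)
  show "e * ?f = ?f" "?f * e = ?f"
    using assms(1,2) by (simp_all add: mult.assoc)
  show "G \<asymp> ?f"
    by (rule eqvI[OF assms(1) f, of "G * (U * e)" "e * V * G"])
      (use assms(1-4) in \<open>simp_all add: mult.assoc GG\<close>)
qed

text \<open>The identity of the range of \<open>P\<close> factors as \<open>A' * B'\<close> through the range of \<open>F = I + c * d\<close>,
  which is the direct sum of the ranges of \<open>I\<close> and \<open>e\<close>.\<close>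

lemma eqv_compression:
  assumes M: "P \<in> idem" "A \<in> M" "B \<in> M" "U \<in> M" "V \<in> M" "I \<in> idem" "c \<in> M" "d \<in> M"
    and AB: "A * I = A" "I * B = B"
    and cd: "c * e = c" "e * d = d" "d * c = e" "I * c = 0" "d * I = 0"
    and P: "P = P * A * B * P + U * e * V"
  defines "F \<equiv> I + c * d"
  obtains Q where "Q \<in> idem" "P \<asymp> Q" "F - Q \<in> idem" "Q * (F - Q) = 0" "(F - Q) * Q = 0"
    "F - Q = (I - B * P * A) + c * d - B * P * U * d - c * V * P * A - c * V * P * U * d"
proof -
  \<comment> \<open>A block row and a block column with respect to \<open>I\<close> and the copy
    \<open>c * d\<close> of \<open>e\<close>. The product \<open>d * c = e\<close> restores the term
    \<open>U * e * V\<close>, while \<open>A * c = 0\<close> and \<open>d * B = 0\<close> remove the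
    mixed terms.\<close>
  define A' B' where "A' = P * A + P * U * d" and "B' = B * P + c * V * P"
  have Ac': "A * c = 0"
    by (metis AB(1) cd(4) mult.assoc mult_zero_right)
  have dB': "d * B = 0"
    by (metis AB(2) cd(5) mult.assoc mult_zero_left)
  have Ac: "A * (c * x) = 0" and dB: "d * (B * x) = 0" for x
    by (simp_all add: mult.assoc[symmetric] Ac' dB')
  have dc: "d * (c * x) = e * x" and ec: "c * (e * x) = c * x" and ed: "e * (d * x) = d * x" for x
    by (simp_all add: mult.assoc[symmetric] cd)
  have PP: "P * P = P" "P * (P * x) = P * x" for x
    using M(1) by simp_all
  have IB: "I * (B * x) = B * x" and Ic: "I * (c * x) = 0" for x
    by (simp_all add: mult.assoc[symmetric] AB cd)
  have "A' * B' = P * (P * A * B * P + U * e * V) * P"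
    by (simp add: A'_def B'_def algebra_simps PP Ac dB dc ed ec)
  also have "\<dots> = P * P * P"
    by (rule arg_cong[where f = "\<lambda>x. P * x * P"]) (rule P[symmetric])
  finally have A'B': "A' * B' = P"
    by (simp add: PP)
  have PA': "P * A' = A'"
    by (simp add: A'_def algebra_simps PP)
  have FB': "F * B' = B'"
    by (simp add: F_def B'_def algebra_simps IB Ic dB dc ec)
  have A'F: "A' * F = A'"
    by (simp add: F_def A'_def algebra_simps AB dc cd Ac)
  have closed: "A' \<in> M" "B' \<in> M"
    using M by (simp_all add: A'_def B'_def)
  define Q where "Q = B' * A'"
  have "B' * A' * (B' * A') = B' * ((A' * B') * A')"
    by (simp add: mult.assoc)
  then have QQ: "Q * Q = Q"
    unfolding Q_def A'B' PA' .
  then have Q: "Q \<in> idem"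
    using closed by (intro idemI) (simp_all add: Q_def)
  have "P \<asymp> Q"
    by (rule eqvI[OF M(1) Q closed]) (simp_all add: A'B' Q_def)
  have F: "F \<in> idem"
    unfolding F_def
  proof (rule idem_add)
    show "c * d * I = 0" by (simp add: mult.assoc cd)
    show "c * d \<in> idem" using M by (intro idemI) (simp_all add: mult.assoc dc ed cd)
    show "I * (c * d) = 0" by (simp add: Ic)
  qed (rule M)
  have FQ: "F * Q = Q"
    by (simp add: Q_def mult.assoc[symmetric] FB')
  have QF: "Q * F = Q"
    by (simp add: Q_def mult.assoc A'F)
  have 0: "Q * (F - Q) = 0" "(F - Q) * Q = 0"
    by (simp_all add: QQ FQ QF left_diff_distrib right_diff_distrib)
  have "(F - Q) * (F - Q) = F - Q"
    by (simp add: QQ FQ QF left_diff_distrib right_diff_distrib idem_idem[OF F])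
  then have G: "F - Q \<in> idem"
    using F Q by (intro idemI) simp_all
  \<comment> \<open>The expansion lets membership in an ideal be checked summand by summand: all but
    the first contain \<open>c\<close> or \<open>d\<close>.\<close>
  have "F - Q = (I - B * P * A) + c * d - B * P * U * d - c * V * P * A - c * V * P * U * d"
    by (simp add: F_def Q_def A'_def B'_def algebra_simps PP)
  with Q \<open>P \<asymp> Q\<close> G 0 show ?thesis
    by (rule that)
qed

end

section \<open>Infinite matrices of operators\<close>

text \<open>Matrices of operators on \<open>'x\<close> of all finite sizes act on \<open>nat \<Rightarrow> 'x\<close>. As elements of
  the type-class ring \<open>(nat \<Rightarrow> 'x) endo\<close> they can be added and multiplied without regard to
  dimensions.\<close>

typedef (overloaded) ('a::ab_group_add) endo = "{f :: 'a \<Rightarrow> 'a. Modules.additive f}"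
  morphisms app Endo
  by (rule exI[of _ "\<lambda>x. x"]) (simp add: Modules.additive_def)

setup_lifting type_definition_endo

instantiation endo :: (ab_group_add) ring
begin

lift_definition zero_endo :: "'a endo" is "\<lambda>x. 0" by (simp add: Modules.additive_def)
lift_definition plus_endo :: "'a endo \<Rightarrow> 'a endo \<Rightarrow> 'a endo" is "\<lambda>f g x. f x + g x"
  by (simp add: Modules.additive_def)
lift_definition uminus_endo :: "'a endo \<Rightarrow> 'a endo" is "\<lambda>f x. - f x"
  by (simp add: Modules.additive_def)
lift_definition minus_endo :: "'a endo \<Rightarrow> 'a endo \<Rightarrow> 'a endo" is "\<lambda>f g x. f x - g x"
  by (simp add: Modules.additive_def)
lift_definition times_endo :: "'a endo \<Rightarrow> 'a endo \<Rightarrow> 'a endo" is "\<lambda>f g x. f (g x)"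
  by (simp add: Modules.additive_def)

instance
  by standard (transfer; auto simp: fun_eq_iff Modules.additive_def algebra_simps)+

end

lemma app_simps [simp]:
  "app 0 x = 0" "app (f + g) x = app f x + app g x" "app (- f) x = - app f x"
  "app (f - g) x = app f x - app g x" "app (f * g) x = app f (app g x)"
  by (transfer, simp)+

lemma app_sum_apply:
  fixes f :: "'i \<Rightarrow> (nat \<Rightarrow> 'a::ab_group_add) endo"
  shows "app (\<Sum>i\<in>A. f i) v k = (\<Sum>i\<in>A. app (f i) v k)"
  by (induction A rule: infinite_finite_induct) simp_all

lemma endo_eqI:
  fixes S T :: "(nat \<Rightarrow> 'a::ab_group_add) endo"
  assumes "\<And>v i. app S v i = app T v i" shows "S = T"
  using assms by (metis app_inject ext)

lemma additive_sum_fun: "Modules.additive f \<Longrightarrow> f (\<Sum>i\<in>A. g i) = (\<Sum>i\<in>A. f (g i))"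
  by (rule Modules.additive.sum)

definition op :: "nat \<Rightarrow> nat \<Rightarrow> (nat \<Rightarrow> nat \<Rightarrow> 'x \<Rightarrow> 'x) \<Rightarrow> (nat \<Rightarrow> 'x::ab_group_add) endo"
  where "op m n a = Endo (\<lambda>v i. if i < m then \<Sum>j<n. a i j (v j) else 0)"

lemma app_op:
  assumes "\<And>i j. i < m \<Longrightarrow> j < n \<Longrightarrow> Modules.additive (a i j)"
  shows "app (op m n a) v i = (if i < m then \<Sum>j<n. a i j (v j) else 0)"
proof -
  have "Modules.additive (\<lambda>v i. if i < m then \<Sum>j<n. a i j (v j) else 0)"
    unfolding Modules.additive_def
    by (auto simp: fun_eq_iff sum.distrib[symmetric] intro!: sum.cong Modules.additive.add assms)
  then show ?thesis by (simp add: op_def Endo_inverse)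
qed

lemma op_cong:
  "(\<And>i j. i < m \<Longrightarrow> j < n \<Longrightarrow> a i j = b i j) \<Longrightarrow> op m n a = op m n b"
  unfolding op_def by (intro arg_cong[of _ _ Endo] ext) auto

text \<open>Bounded operators enter the algebraic part only as a unital ring of additive maps; the
  topology returns in the last section.\<close>

locale operator_algebra =
  fixes R :: "('x::ab_group_add \<Rightarrow> 'x) set"
  assumes additive_R: "f \<in> R \<Longrightarrow> Modules.additive f"
    and zero_R [simp, intro]: "(\<lambda>_. 0) \<in> R"
    and id_R [simp, intro]: "id \<in> R"
    and add_R: "f \<in> R \<Longrightarrow> g \<in> R \<Longrightarrow> (\<lambda>x. f x + g x) \<in> R"
    and uminus_R: "f \<in> R \<Longrightarrow> (\<lambda>x. - f x) \<in> R"
    and comp_R: "f \<in> R \<Longrightarrow> g \<in> R \<Longrightarrow> (\<lambda>x. f (g x)) \<in> R"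
begin

text \<open>Closure under negatives follows by multiplying with -id. The case \<open>J = R\<close>
  is included, so the same closure lemmas serve the ring and the ideal.\<close>

definition op_ideal :: "('x \<Rightarrow> 'x) set \<Rightarrow> bool"
  where "op_ideal J \<longleftrightarrow> J \<subseteq> R \<and> (\<lambda>_. 0) \<in> J \<and>
    (\<forall>f\<in>J. \<forall>g\<in>J. (\<lambda>x. f x + g x) \<in> J) \<and>
    (\<forall>f\<in>R. \<forall>g\<in>J. (\<lambda>x. f (g x)) \<in> J) \<and> (\<forall>f\<in>J. \<forall>g\<in>R. (\<lambda>x. f (g x)) \<in> J)"

lemma op_ideal_R: "op_ideal R"
  by (simp add: op_ideal_def add_R comp_R)

lemma zero_apply: "f \<in> R \<Longrightarrow> f 0 = 0"
  using additive_R Modules.additive.zero by blast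

lemma sum_in_ideal:
  "op_ideal J \<Longrightarrow> (\<And>i. i \<in> A \<Longrightarrow> f i \<in> J) \<Longrightarrow> (\<lambda>x. \<Sum>i\<in>A. f i x) \<in> J"
  by (induction A rule: infinite_finite_induct) (auto simp: op_ideal_def)

definition entries_in :: "('x \<Rightarrow> 'x) set \<Rightarrow> nat \<Rightarrow> nat \<Rightarrow> (nat \<Rightarrow> nat \<Rightarrow> 'x \<Rightarrow> 'x) \<Rightarrow> bool"
  where "entries_in J m n a \<longleftrightarrow> (\<forall>i<m. \<forall>j<n. a i j \<in> J)"

definition opmats :: "('x \<Rightarrow> 'x) set \<Rightarrow> (nat \<Rightarrow> 'x) endo set"
  where "opmats J = {op m n a | m n a. entries_in J m n a}"

lemma app_op_R: "entries_in R m n a \<Longrightarrow>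
    app (op m n a) v i = (if i < m then \<Sum>j<n. a i j (v j) else 0)"
  by (rule app_op) (simp add: entries_in_def additive_R)

lemma entries_in_R: "op_ideal J \<Longrightarrow> entries_in J m n a \<Longrightarrow> entries_in R m n a"
  by (auto simp: op_ideal_def entries_in_def)

lemma op_in_opmats: "entries_in J m n a \<Longrightarrow> op m n a \<in> opmats J"
  by (auto simp: opmats_def)

lemma entries_mult:
  assumes "entries_in R m n a" "op_ideal J" "entries_in J n k b"
  shows "entries_in J m k (\<lambda>i l x. \<Sum>j<n. a i j (b j l x))"
  using assms(1,3) unfolding entries_in_def
  by (auto intro!: sum_in_ideal[OF assms(2)] simp: assms(2)[unfolded op_ideal_def])

lemma entries_mult':
  assumes "op_ideal J" "entries_in J m n a" "entries_in R n k b"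
  shows "entries_in J m k (\<lambda>i l x. \<Sum>j<n. a i j (b j l x))"
  using assms(2,3) unfolding entries_in_def
  by (auto intro!: sum_in_ideal[OF assms(1)] simp: assms(1)[unfolded op_ideal_def])

lemma op_mult:
  assumes "entries_in R m n a" "entries_in R n k b"
  shows "op m n a * op n k b = op m k (\<lambda>i l x. \<Sum>j<n. a i j (b j l x))"
proof (rule endo_eqI)
  fix v i
  have "(\<Sum>j<n. a i j (\<Sum>l<k. b j l (v l))) = (\<Sum>j<n. \<Sum>l<k. a i j (b j l (v l)))" if "i < m"
    using assms that by (intro sum.cong refl additive_sum_fun) (auto simp: entries_in_def additive_R)
  also have "\<dots> = (\<Sum>l<k. \<Sum>j<n. a i j (b j l (v l)))"
    by (rule sum.swap)
  finally show "app (op m n a * op n k b) v i = app (op m k (\<lambda>i l x. \<Sum>j<n. a i j (b j l x))) v i"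
    using assms entries_mult[OF assms(1) op_ideal_R assms(2)] by (simp add: app_op_R)
qed

lemma op_add:
  assumes "entries_in R m n a" "entries_in R m n b"
  shows "op m n a + op m n b = op m n (\<lambda>i j x. a i j x + b i j x)"
  using assms
  by (intro endo_eqI, subst app_op_R) (auto simp: app_op_R sum.distrib entries_in_def add_R)

lemma op_uminus:
  assumes "entries_in R m n a"
  shows "- op m n a = op m n (\<lambda>i j x. - a i j x)"
  using assms
  by (intro endo_eqI, subst app_op_R) (auto simp: app_op_R sum_negf entries_in_def uminus_R)

text \<open>Zero padding is invisible in \<open>endo\<close>, so any two matrices can be brought to
  a common square size.\<close>

lemma op_pad:
  assumes "entries_in R m n a" "m \<le> m'" "n \<le> n'"
  shows "op m n a = op m' n' (\<lambda>i j. if i < m \<and> j < n then a i j else (\<lambda>_. 0))"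
proof (rule endo_eqI)
  fix v i
  have "(\<Sum>j<n'. (if i < m \<and> j < n then a i j else (\<lambda>_. 0)) (v j)) = (\<Sum>j<n. a i j (v j))"
    if "i < m"
    using assms(3) that by (intro sum.mono_neutral_cong_right) auto
  moreover have "entries_in R m' n' (\<lambda>i j. if i < m \<and> j < n then a i j else (\<lambda>_. 0))"
    using assms(1) by (auto simp: entries_in_def)
  ultimately show "app (op m n a) v i =
      app (op m' n' (\<lambda>i j. if i < m \<and> j < n then a i j else (\<lambda>_. 0))) v i"
    using assms by (auto simp: app_op_R intro!: sum.neutral[symmetric])
qed

lemma opmats_square:
  assumes "x \<in> opmats J" "op_ideal J"
  shows "\<exists>N. \<forall>n\<ge>N. \<exists>a. x = op n n a \<and> entries_in J n n a"
proof -
  obtain m k a where x: "x = op m k a" "entries_in J m k a"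
    using assms(1) by (auto simp: opmats_def)
  have "\<exists>a. x = op n n a \<and> entries_in J n n a" if n: "n \<ge> max m k" for n
  proof (intro exI conjI)
    show "entries_in J n n (\<lambda>i j. if i < m \<and> j < k then a i j else (\<lambda>_. 0))"
      using x(2) assms(2) by (auto simp: entries_in_def op_ideal_def)
    show "x = op n n (\<lambda>i j. if i < m \<and> j < k then a i j else (\<lambda>_. 0))"
      using op_pad[of m k a n n] x entries_in_R[OF assms(2)] n by simp
  qed
  then show ?thesis by blast
qed

lemma opmats_common:
  assumes "x \<in> opmats J" "op_ideal J" "y \<in> opmats K" "op_ideal K"
  obtains n a b where "x = op n n a" "entries_in J n n a" "y = op n n b" "entries_in K n n b"
  using opmats_square[OF assms(1,2)] opmats_square[OF assms(3,4)] that by (metis nat_le_linear)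

lemma opmats_mult_left:
  assumes "op_ideal J" "x \<in> opmats R" "y \<in> opmats J" shows "x * y \<in> opmats J"
proof -
  obtain n a b where "x = op n n a" "entries_in R n n a" "y = op n n b" "entries_in J n n b"
    using opmats_common[OF assms(2) op_ideal_R assms(3,1)] .
  then show ?thesis
    using entries_in_R[OF assms(1)] entries_mult[OF _ assms(1)] by (simp add: op_mult op_in_opmats)
qed

lemma opmats_mult_right:
  assumes "op_ideal J" "x \<in> opmats J" "y \<in> opmats R" shows "x * y \<in> opmats J"
proof -
  obtain n a b where "x = op n n a" "entries_in J n n a" "y = op n n b" "entries_in R n n b"
    using opmats_common[OF assms(2,1,3) op_ideal_R] .
  then show ?thesis
    using entries_in_R[OF assms(1)] entries_mult'[OF assms(1)] by (simp add: op_mult op_in_opmats)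
qed

lemma opmats_add:
  assumes "op_ideal J" "x \<in> opmats J" "y \<in> opmats J" shows "x + y \<in> opmats J"
proof -
  obtain n a b where ab: "x = op n n a" "entries_in J n n a" "y = op n n b" "entries_in J n n b"
    using opmats_common[OF assms(2,1,3,1)] .
  then have "entries_in J n n (\<lambda>i j x. a i j x + b i j x)"
    using assms(1) by (simp add: entries_in_def op_ideal_def)
  then show ?thesis
    using ab entries_in_R[OF assms(1)] by (simp add: op_add op_in_opmats)
qed

lemma opmats_uminus:
  assumes "op_ideal J" "x \<in> opmats J" shows "- x \<in> opmats J"
proof -
  obtain n m a where a: "x = op m n a" "entries_in J m n a"
    using assms by (auto simp: opmats_def)
  have "(\<lambda>x. - f x) \<in> J" if "f \<in> J" for f
    using assms(1) that uminus_R[OF id_R] unfolding op_ideal_def by fastforce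
  then have "entries_in J m n (\<lambda>i j x. - a i j x)"
    using a(2) by (simp add: entries_in_def)
  then show ?thesis
    using a entries_in_R[OF assms(1)] by (simp add: op_uminus op_in_opmats)
qed

lemma opmats_diff: "op_ideal J \<Longrightarrow> x \<in> opmats J \<Longrightarrow> y \<in> opmats J \<Longrightarrow> x - y \<in> opmats J"
  using opmats_add[of J x "- y"] opmats_uminus by simp

lemma op_zero: "op 0 0 a = 0"
  by (rule endo_eqI) (simp add: app_op)

sublocale nonunital_subring "opmats R"
proof
  show "0 \<in> opmats R"
    using op_in_opmats[of R 0 0] op_zero by (metis entries_in_def not_less_zero)
qed (simp_all add: opmats_add opmats_uminus opmats_mult_left op_ideal_R)

lemma opmats_R: "op_ideal J \<Longrightarrow> x \<in> opmats J \<Longrightarrow> x \<in> opmats R"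
  unfolding opmats_def using entries_in_R by blast

text \<open>The matrix unit at position (i, j) with an operator as coefficient; its nominal size is
  the smallest that contains this position.\<close>

definition sng :: "nat \<Rightarrow> nat \<Rightarrow> ('x \<Rightarrow> 'x) \<Rightarrow> (nat \<Rightarrow> 'x) endo"
  where "sng i j r = op (Suc i) (Suc j) (\<lambda>k l. if k = i \<and> l = j then r else (\<lambda>_. 0))"

lemma sng_in_opmats:
  assumes "op_ideal J" "r \<in> J" shows "sng i j r \<in> opmats J"
  unfolding sng_def using assms by (intro op_in_opmats) (auto simp: entries_in_def op_ideal_def)

lemma app_sng: "r \<in> R \<Longrightarrow> app (sng i j r) v k = (if k = i then r (v j) else 0)"
  unfolding sng_def
  by (subst app_op_R) (auto simp: entries_in_def if_distrib[where f = "\<lambda>f. f _"] cong: if_cong)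

lemma sng_mult:
  "r \<in> R \<Longrightarrow> s \<in> R \<Longrightarrow> sng i j r * sng k l s = (if j = k then sng i l (\<lambda>x. r (s x)) else 0)"
  by (rule endo_eqI) (simp add: app_sng comp_R zero_apply)

lemma op_sum:
  assumes "entries_in R m n a"
  shows "op m n a = (\<Sum>i<m. \<Sum>j<n. sng i j (a i j))"
proof (rule endo_eqI)
  fix v k
  have "(\<Sum>i<m. \<Sum>j<n. app (sng i j (a i j)) v k) = (\<Sum>i<m. if k = i then \<Sum>j<n. a k j (v j) else 0)"
    using assms by (intro sum.cong refl) (auto simp: app_sng entries_in_def)
  also have "\<dots> = (if k < m then \<Sum>j<n. a k j (v j) else 0)"
    by (simp add: sum.delta)
  finally show "app (op m n a) v k = app (\<Sum>i<m. \<Sum>j<n. sng i j (a i j)) v k"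
    using assms by (simp add: app_op_R app_sum_apply)
qed

lemma op_inject:
  assumes "op m n a = op m n b" "entries_in R m n a" "entries_in R m n b" "i < m" "j < n"
  shows "a i j = b i j"
proof
  fix x
  have "app (op m n c) (\<lambda>l. if l = j then x else 0) i = c i j x" if "entries_in R m n c" for c
  proof -
    have "(\<Sum>l<n. c i l (if l = j then x else 0)) = (\<Sum>l<n. if l = j then c i j x else 0)"
      using that assms(4) by (intro sum.cong refl) (auto simp: entries_in_def zero_apply)
    then show ?thesis using that assms(4,5) by (simp add: app_op_R)
  qed
  then show "a i j x = b i j x" using assms by metis
qed

text \<open>These idempotents stand in for the missing identity: being fixed by them on the left and
  on the right records the size of a matrix. Their classes are the multiples of the class of
  \<open>id\<close>.\<close>

definition unit_op :: "nat \<Rightarrow> (nat \<Rightarrow> 'x) endo"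
  where "unit_op k = op k k (\<lambda>i j. if i = j then id else (\<lambda>_. 0))"

lemma entries_unit: "entries_in R k l (\<lambda>i j. if i = j then id else (\<lambda>_. 0))"
  by (auto simp: entries_in_def)

lemma app_unit_op: "app (unit_op k) v i = (if i < k then v i else 0)"
  unfolding unit_op_def
  by (subst app_op_R[OF entries_unit]) (simp add: if_distrib[where f = "\<lambda>f. f _"] cong: if_cong)

lemma unit_op_idem [simp, intro]: "unit_op k \<in> idem"
  by (rule idemI) (auto simp: unit_op_def intro!: op_in_opmats entries_unit,
      auto simp: unit_op_def[symmetric] app_unit_op intro!: endo_eqI)

lemma op_mult_unit: "entries_in R m n a \<Longrightarrow> op m n a * unit_op n = op m n a"
  by (rule endo_eqI) (simp add: app_unit_op app_op_R)

lemma unit_mult_op: "entries_in R m n a \<Longrightarrow> unit_op m * op m n a = op m n a"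
  by (rule endo_eqI) (simp add: app_unit_op app_op_R)

lemma unit_op_Suc: "unit_op (Suc k) = unit_op k + sng k k id"
  by (rule endo_eqI) (auto simp: app_unit_op app_sng)

end

section \<open>Matrices with operator entries and their classes\<close>

lemma sum_lessThan_add:
  fixes f :: "nat \<Rightarrow> 'a::comm_monoid_add"
  shows "(\<Sum>j<m + n. f j) = (\<Sum>j<m. f j) + (\<Sum>j<n. f (m + j))"
  by (induction n) (simp_all add: add.assoc)

context operator_algebra
begin

notation eqv (infix \<open>\<asymp>\<close> 50)

text \<open>The record repeats \<open>operator_ring\<close> over an abstract carrier, so that both
  coincide by unfolding once \<open>R\<close> consists of the bounded operators.\<close>

definition ring_of :: "('x \<Rightarrow> 'x) ring" where
  "ring_of = \<lparr>carrier = R, monoid.mult = (\<lambda>f g. f \<circ> g), one = id,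
     ring.zero = (\<lambda>x. 0), add = (\<lambda>f g x. f x + g x)\<rparr>"

lemma ring_of_simps [simp]:
  "carrier ring_of = R" "f \<otimes>\<^bsub>ring_of\<^esub> g = (\<lambda>x. f (g x))" "\<one>\<^bsub>ring_of\<^esub> = id"
  "\<zero>\<^bsub>ring_of\<^esub> = (\<lambda>x. 0)" "f \<oplus>\<^bsub>ring_of\<^esub> g = (\<lambda>x. f x + g x)"
  by (simp_all add: ring_of_def o_def)

lemma abelian_monoid_ring_of: "abelian_monoid ring_of"
  by (rule abelian_monoidI) (auto simp: add_R algebra_simps)

lemma finsum_ring_of:
  assumes "finite A" "\<And>i. i \<in> A \<Longrightarrow> f i \<in> R"
  shows "finsum ring_of f A = (\<lambda>x. \<Sum>i\<in>A. f i x)"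
proof -
  interpret abelian_monoid ring_of by (rule abelian_monoid_ring_of)
  show ?thesis
    using assms by (induction A) (auto simp: Pi_def)
qed

text \<open>Passage from matrices over a ring record to \<open>endo\<close>. It is multiplicative,
  but injective only for fixed dimensions, because it forgets zero padding.\<close>

definition mop :: "('x \<Rightarrow> 'x) mat \<Rightarrow> (nat \<Rightarrow> 'x) endo"
  where "mop A = op (dim_row A) (dim_col A) (\<lambda>i j. A $$ (i, j))"

lemma mats_iff:
  "A \<in> mats ring_of m n \<longleftrightarrow>
     dim_row A = m \<and> dim_col A = n \<and> entries_in R m n (\<lambda>i j. A $$ (i, j))"
  by (auto simp: mats_def entries_in_def)

lemma mop_in_opmats: "A \<in> mats ring_of m n \<Longrightarrow> mop A \<in> opmats R"
  by (simp add: mats_iff mop_def op_in_opmats)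

lemma mop_inject:
  "A \<in> mats ring_of m n \<Longrightarrow> B \<in> mats ring_of m n \<Longrightarrow> mop A = mop B \<Longrightarrow> A = B"
  by (intro eq_matI) (auto simp: mats_iff mop_def intro: op_inject)

lemma mop_mat:
  "entries_in R m n a \<Longrightarrow> mat m n (\<lambda>(i, j). a i j) \<in> mats ring_of m n"
  "entries_in R m n a \<Longrightarrow> mop (mat m n (\<lambda>(i, j). a i j)) = op m n a"
  by (auto simp: mats_iff mop_def entries_in_def app_op_R intro!: endo_eqI)

lemma mat_mult_index:
  assumes "A \<in> mats ring_of m n" "B \<in> mats ring_of n k" "i < m" "j < k"
  shows "mat_mult ring_of A B $$ (i, j) = (\<lambda>x. \<Sum>l<n. (A $$ (i, l)) ((B $$ (l, j)) x))"
  using assms by (auto simp: mat_mult_def mats_iff entries_in_def comp_R intro!: finsum_ring_of)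

lemma mat_mult_eq:
  assumes "A \<in> mats ring_of m n" "B \<in> mats ring_of n k"
  shows "mat_mult ring_of A B =
    mat m k (\<lambda>(i, j) x. \<Sum>l<n. (A $$ (i, l)) ((B $$ (l, j)) x))"
  by (rule eq_matI) (use assms in \<open>auto simp: mat_mult_index[OF assms], auto simp: mat_mult_def mats_iff\<close>)

lemma mat_mult_mats:
  assumes "A \<in> mats ring_of m n" "B \<in> mats ring_of n k"
  shows "mat_mult ring_of A B \<in> mats ring_of m k"
    and "mop (mat_mult ring_of A B) = mop A * mop B"
proof -
  have eq: "mat_mult ring_of A B =
      mat m k (\<lambda>(i, j). (\<lambda>i j x. \<Sum>l<n. (A $$ (i, l)) ((B $$ (l, j)) x)) i j)"
    using mat_mult_eq[OF assms] by simp
  have e: "entries_in R m k (\<lambda>i j x. \<Sum>l<n. (A $$ (i, l)) ((B $$ (l, j)) x))"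
    using assms by (intro entries_mult op_ideal_R) (auto simp: mats_iff)
  show "mat_mult ring_of A B \<in> mats ring_of m k"
    unfolding eq by (rule mop_mat(1)[OF e])
  show "mop (mat_mult ring_of A B) = mop A * mop B"
    unfolding eq mop_mat(2)[OF e] using assms by (simp add: mop_def op_mult mats_iff)
qed

lemma IP_iff: "P \<in> IP ring_of n \<longleftrightarrow> P \<in> mats ring_of n n \<and> mop P \<in> idem"
proof -
  have "mat_mult ring_of P P = P \<longleftrightarrow> mop P * mop P = mop P" if "P \<in> mats ring_of n n"
    using mat_mult_mats[OF that that] mop_inject[OF _ that] by auto
  moreover have "mop P \<in> idem \<longleftrightarrow> mop P * mop P = mop P" if "P \<in> mats ring_of n n"
    using mop_in_opmats[OF that] idemI idem_idem by blast
  ultimately show ?thesis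
    unfolding IP_def by blast
qed

lemma IP_infE:
  assumes "P \<in> IP_inf ring_of"
  obtains n where "n \<ge> 1" "P \<in> mats ring_of n n" "mop P \<in> idem"
  using assms by (auto simp: IP_inf_def IP_iff)

lemma IP_inf_idem: "P \<in> IP_inf ring_of \<Longrightarrow> mop P \<in> idem"
  by (auto simp: IP_inf_def IP_iff)

lemma unit_mop:
  "A \<in> mats ring_of m n \<Longrightarrow> unit_op m * mop A = mop A"
  "A \<in> mats ring_of m n \<Longrightarrow> mop A * unit_op n = mop A"
  by (auto simp: mop_def mats_iff op_mult_unit unit_mult_op)

text \<open>Converse of \<open>unit_mop\<close>. Multiplication by the two unit idempotents cuts a
  large square representation down to its upper left corner, and by assumption this changes
  nothing.\<close>

lemma compress_opmats:
  assumes "x \<in> opmats R" "unit_op m * x = x" "x * unit_op n = x"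
  obtains A where "A \<in> mats ring_of m n" "x = mop A"
proof -
  obtain N where N: "\<forall>k\<ge>N. \<exists>a. x = op k k a \<and> entries_in R k k a"
    using opmats_square[OF assms(1) op_ideal_R] by blast
  define k where "k = max N (max m n)"
  obtain a where a: "x = op k k a" "entries_in R k k a"
    using N unfolding k_def by (metis max.cobounded1)
  have le: "m \<le> k" "n \<le> k" by (simp_all add: k_def)
  then have e: "entries_in R m n a" using a(2) by (auto simp: entries_in_def)
  have "op m n a = unit_op m * op k k a * unit_op n"
  proof (rule endo_eqI)
    fix v i
    have "(\<Sum>j<k. a i j (if j < n then v j else 0)) = (\<Sum>j<n. a i j (v j))" if "i < k"
      using a(2) that le(2)
      by (intro sum.mono_neutral_cong_right) (auto simp: entries_in_def zero_apply)
    then show "app (op m n a) v i = app (unit_op m * op k k a * unit_op n) v i"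
      using a(2) e le by (simp add: app_op_R app_unit_op)
  qed
  also have "\<dots> = x" using a(1) assms by simp
  finally show ?thesis using that mop_mat[OF e] by metis
qed

lemma idem_is_mop:
  assumes "p \<in> idem" obtains P where "P \<in> IP_inf ring_of" "mop P = p"
proof -
  obtain N where "\<forall>n\<ge>N. \<exists>a. p = op n n a \<and> entries_in R n n a"
    using opmats_square[OF idem_in_M[OF assms] op_ideal_R] by blast
  \<comment> \<open>The size is \<open>Suc N\<close> because \<open>IP_inf\<close> admits only sizes
    at least one.\<close>
  then obtain a where a: "p = op (Suc N) (Suc N) a" "entries_in R (Suc N) (Suc N) a"
    by (meson le_SucI order_refl)
  then have "mat (Suc N) (Suc N) (\<lambda>(i, j). a i j) \<in> IP ring_of (Suc N)"
    using assms mop_mat[OF a(2)] by (simp add: IP_iff)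
  then show ?thesis
    using that mop_mat[OF a(2)] a(1) by (auto simp: IP_inf_def)
qed

text \<open>This frees the relation from dimensions. Conversely, factors in \<open>endo\<close> may
  be too large; once normalised by \<open>eqvE\<close> they are fixed by the unit idempotents of the
  sizes of \<open>P\<close> and \<open>Q\<close> and hence come from matrices of the right
  shape.\<close>

lemma sim0_iff:
  "(P, Q) \<in> sim0 ring_of \<longleftrightarrow> P \<in> IP_inf ring_of \<and> Q \<in> IP_inf ring_of \<and> mop P \<asymp> mop Q"
proof
  assume "(P, Q) \<in> sim0 ring_of"
  then obtain m n A B where mn: "m \<ge> 1" "n \<ge> 1" "P \<in> IP ring_of m" "Q \<in> IP ring_of n"
    and AB: "A \<in> mats ring_of m n" "B \<in> mats ring_of n m"
      "P = mat_mult ring_of A B" "Q = mat_mult ring_of B A"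
    by (auto simp: sim0_def)
  have "P \<in> IP_inf ring_of" "Q \<in> IP_inf ring_of"
    using mn by (auto simp: IP_inf_def)
  moreover have "mop P \<asymp> mop Q"
    using mn(3,4) AB by (intro eqvI[of "mop P" "mop Q" "mop A" "mop B"])
      (simp_all add: IP_iff mop_in_opmats mat_mult_mats)
  ultimately show "P \<in> IP_inf ring_of \<and> Q \<in> IP_inf ring_of \<and> mop P \<asymp> mop Q"
    by blast
next
  assume PQ: "P \<in> IP_inf ring_of \<and> Q \<in> IP_inf ring_of \<and> mop P \<asymp> mop Q"
  then obtain m n where m: "m \<ge> 1" "P \<in> mats ring_of m m" "mop P \<in> idem"
    and n: "n \<ge> 1" "Q \<in> mats ring_of n n" "mop Q \<in> idem"
    by (meson IP_infE)
  obtain a b where ab: "a \<in> opmats R" "b \<in> opmats R" "mop P = a * b" "mop Q = b * a"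
    "mop P * a = a" "a * mop Q = a" "mop Q * b = b" "b * mop P = b"
    using PQ eqvE by blast
  obtain A where A: "A \<in> mats ring_of m n" "a = mop A"
    using compress_opmats[OF ab(1), of m n] unit_mop[OF m(2)] unit_mop[OF n(2)] ab(5,6)
    by (metis mult.assoc)
  obtain B where B: "B \<in> mats ring_of n m" "b = mop B"
    using compress_opmats[OF ab(2), of n m] unit_mop[OF m(2)] unit_mop[OF n(2)] ab(7,8)
    by (metis mult.assoc)
  have "P = mat_mult ring_of A B" "Q = mat_mult ring_of B A"
    using mop_inject m(2) n(2) A B ab(3,4) mat_mult_mats by metis+
  then show "(P, Q) \<in> sim0 ring_of"
    using A(1) B(1) m n by (auto simp: sim0_def IP_iff)
qed

section \<open>The semigroup V described by idempotents of the ring of infinite matrices\<close>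

definition cl :: "(nat \<Rightarrow> 'x) endo \<Rightarrow> ('x \<Rightarrow> 'x) mat set"
  where "cl p = {P \<in> IP_inf ring_of. p \<asymp> mop P}"

lemma mem_cl: "P \<in> cl p \<longleftrightarrow> P \<in> IP_inf ring_of \<and> p \<asymp> mop P"
  by (simp add: cl_def)

lemma V_class_eq: "P \<in> IP_inf ring_of \<Longrightarrow> V_class ring_of P = cl (mop P)"
  unfolding set_eq_iff mem_cl by (simp add: V_class_def sim0_iff)

lemma cl_eq_iff:
  assumes "p \<in> idem" shows "cl p = cl q \<longleftrightarrow> p \<asymp> q"
proof
  assume eq: "cl p = cl q"
  obtain P where P: "P \<in> IP_inf ring_of" "mop P = p"
    using assms by (rule idem_is_mop)
  then have "P \<in> cl p"
    unfolding mem_cl using eqv_refl[OF assms] by simp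
  then show "p \<asymp> q"
    unfolding eq mem_cl P(2) using eqv_sym by blast
next
  assume "p \<asymp> q"
  then show "cl p = cl q" unfolding set_eq_iff mem_cl using eqv_trans eqv_sym by blast
qed

lemma cl_nonempty: assumes "p \<in> idem" shows "cl p \<noteq> {}"
proof -
  obtain P where "P \<in> IP_inf ring_of" "mop P = p"
    using assms by (rule idem_is_mop)
  then have "P \<in> cl p"
    unfolding mem_cl using eqv_refl[OF assms] by simp
  then show ?thesis by blast
qed

lemma V_carrier_eq: "V_carrier ring_of = cl ` idem"
proof -
  have "V_carrier ring_of = V_class ring_of ` IP_inf ring_of"
    by (auto simp: V_carrier_def quotient_def V_class_def)
  also have "\<dots> = cl ` mop ` IP_inf ring_of"
    by (simp add: V_class_eq image_image)
  also have "mop ` IP_inf ring_of = idem"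
    using IP_inf_idem idem_is_mop by (metis (no_types, lifting) image_eqI image_subsetI subsetI subset_antisym)
  finally show ?thesis .
qed

text \<open>The map \<open>q \<mapsto> shift_op m n * q * unshift_op m n\<close> moves an \<open>n \<times> n\<close> matrix past the
  first \<open>m\<close> rows and columns.\<close>

definition shift_op :: "nat \<Rightarrow> nat \<Rightarrow> (nat \<Rightarrow> 'x) endo"
  where "shift_op m n = op (m + n) n (\<lambda>i j. if i = m + j then id else (\<lambda>_. 0))"

definition unshift_op :: "nat \<Rightarrow> nat \<Rightarrow> (nat \<Rightarrow> 'x) endo"
  where "unshift_op m n = op n (m + n) (\<lambda>i j. if j = m + i then id else (\<lambda>_. 0))"

lemma shift_in_opmats [simp]: "shift_op m n \<in> opmats R" "unshift_op m n \<in> opmats R"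
  by (auto simp: shift_op_def unshift_op_def entries_in_def intro!: op_in_opmats)

lemma app_shift: "app (shift_op m n) v i = (if m \<le> i \<and> i < m + n then v (i - m) else 0)"
proof -
  have "(\<Sum>j<n. (if i = m + j then id else (\<lambda>_. 0)) (v j)) =
      (\<Sum>j<n. if i = m + j then v j else 0)"
    by (intro sum.cong) auto
  also have "\<dots> = (\<Sum>j<n. if j = i - m then (if m \<le> i then v j else 0) else 0)"
    by (intro sum.cong) auto
  also have "\<dots> = (if m \<le> i \<and> i < m + n then v (i - m) else 0)"
    by (auto simp: sum.delta)
  finally show ?thesis
    unfolding shift_op_def by (subst app_op_R) (auto simp: entries_in_def)
qed

lemma app_unshift: "app (unshift_op m n) v i = (if i < n then v (m + i) else 0)"
  unfolding unshift_op_def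
  by (subst app_op_R) (auto simp: entries_in_def if_distrib[where f = "\<lambda>f. f _"] cong: if_cong)

lemma shift_orth:
  "unit_op m * shift_op m n = 0" "unshift_op m n * unit_op m = 0"
  "unshift_op m n * shift_op m n = unit_op n"
  by (auto intro!: endo_eqI simp: app_shift app_unshift app_unit_op)

lemma eqv_shift:
  assumes "q \<in> idem" "unit_op n * q = q"
  shows "q \<asymp> shift_op m n * q * unshift_op m n"
proof -
  have q: "q \<in> opmats R" using assms(1) by simp
  have 1: "q * unshift_op m n * (shift_op m n * q) = q"
    using assms by (simp add: mult.assoc[of "unshift_op m n", symmetric] mult.assoc[of q] shift_orth)
  have 2: "shift_op m n * q * (q * unshift_op m n) = shift_op m n * q * unshift_op m n"
    using assms(1) by (simp add: mult.assoc)
  show ?thesis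
  proof (rule eqvI[OF assms(1)])
    show "shift_op m n * q * unshift_op m n \<in> idem"
    proof (rule idemI)
      have "shift_op m n * q * unshift_op m n * (shift_op m n * q * unshift_op m n) =
          shift_op m n * (q * unshift_op m n * (shift_op m n * q)) * unshift_op m n"
        by (simp only: mult.assoc)
      then show "shift_op m n * q * unshift_op m n * (shift_op m n * q * unshift_op m n) =
          shift_op m n * q * unshift_op m n"
        by (simp only: 1)
    qed (use q in auto)
    show "q = q * unshift_op m n * (shift_op m n * q)" by (rule 1[symmetric])
    show "shift_op m n * q * unshift_op m n = shift_op m n * q * (q * unshift_op m n)"
      by (rule 2[symmetric])
  qed (use q in auto)
qed

lemma orth_shift:
  assumes "unit_op m * p = p" "p * unit_op m = p"
  shows "p * (shift_op m n * q * unshift_op m n) = 0" "shift_op m n * q * unshift_op m n * p = 0"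
proof -
  have "p * (shift_op m n * q * unshift_op m n) = p * unit_op m * (shift_op m n * q * unshift_op m n)"
    by (simp only: assms)
  also have "\<dots> = p * (unit_op m * shift_op m n) * q * unshift_op m n" by (simp only: mult.assoc)
  finally show "p * (shift_op m n * q * unshift_op m n) = 0" by (simp add: shift_orth)
  have "shift_op m n * q * unshift_op m n * p = shift_op m n * q * unshift_op m n * (unit_op m * p)"
    by (simp only: assms)
  also have "\<dots> = shift_op m n * q * (unshift_op m n * unit_op m) * p" by (simp only: mult.assoc)
  finally show "shift_op m n * q * unshift_op m n * p = 0" by (simp add: shift_orth)
qed

text \<open>The idempotent \<open>p\<close> occupies finitely many coordinates, so \<open>q\<close>
  can be moved beyond them.\<close>

lemma orth_copy:
  assumes "p \<in> idem" "q \<in> idem"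
  obtains q' where "q \<asymp> q'" "p * q' = 0" "q' * p = 0"
proof -
  obtain P Q where PQ: "P \<in> IP_inf ring_of" "mop P = p" "Q \<in> IP_inf ring_of" "mop Q = q"
    using assms idem_is_mop by metis
  then obtain m n where "P \<in> mats ring_of m m" "Q \<in> mats ring_of n n"
    by (meson IP_infE)
  then show ?thesis
    using that eqv_shift[OF assms(2), of n m] orth_shift[of m p n q] unit_mop PQ by metis
qed

lemma mop_dsum:
  assumes P: "P \<in> IP ring_of m" and Q: "Q \<in> IP ring_of n"
  shows "mat_dsum ring_of P Q \<in> IP ring_of (m + n)"
    and "mop (mat_dsum ring_of P Q) = mop P + shift_op m n * mop Q * unshift_op m n"
proof -
  note P' = P[unfolded IP_iff mats_iff] and Q' = Q[unfolded IP_iff mats_iff]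
  let ?D = "mat_dsum ring_of P Q"
  have D: "?D \<in> mats ring_of (m + n) (m + n)"
    using P' Q' unfolding mats_iff entries_in_def mat_dsum_def by (auto simp: Let_def)
  show eq: "mop ?D = mop P + shift_op m n * mop Q * unshift_op m n"
  proof (rule endo_eqI)
    fix v i
    have 1: "(\<Sum>j<m. (?D $$ (i, j)) (v j)) = (if i < m then \<Sum>j<m. (P $$ (i, j)) (v j) else 0)"
      if "i < m + n"
      using that P' Q' by (auto simp: mat_dsum_def Let_def)
    have 2: "(\<Sum>j<n. (?D $$ (i, m + j)) (v (m + j))) =
        (if i < m then 0 else \<Sum>j<n. (Q $$ (i - m, j)) (v (m + j)))"
      if "i < m + n"
      using that P' Q' by (auto simp: mat_dsum_def Let_def)
    show "app (mop ?D) v i = app (mop P + shift_op m n * mop Q * unshift_op m n) v i"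
      using D P' Q' 1 2
      by (auto simp: mop_def mats_iff app_op_R app_shift app_unshift sum_lessThan_add)
  qed
  have "mop P \<in> idem" "mop Q \<in> idem" "unit_op m * mop P = mop P" "mop P * unit_op m = mop P"
    "unit_op n * mop Q = mop Q"
    using P Q unit_mop by (auto simp: IP_iff)
  then have "mop ?D \<in> idem"
    unfolding eq using eqv_idem[OF eqv_shift] orth_shift by (intro idem_add) auto
  then show "?D \<in> IP ring_of (m + n)" using D by (simp add: IP_iff)
qed

lemma cl_dsum:
  assumes "P \<in> IP_inf ring_of" "Q \<in> IP_inf ring_of" "mop P \<asymp> x" "mop Q \<asymp> y" "x * y = 0" "y * x = 0"
  shows "mat_dsum ring_of P Q \<in> IP_inf ring_of" "mop (mat_dsum ring_of P Q) \<asymp> x + y"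
proof -
  obtain m n where mn: "m \<ge> 1" "n \<ge> 1" "P \<in> IP ring_of m" "Q \<in> IP ring_of n"
    using assms by (auto simp: IP_inf_def)
  then show "mat_dsum ring_of P Q \<in> IP_inf ring_of"
    using mop_dsum(1)[OF mn(3,4)] by (auto simp: IP_inf_def)
  have *: "unit_op m * mop P = mop P" "mop P * unit_op m = mop P" "unit_op n * mop Q = mop Q"
    using mn unit_mop by (auto simp: IP_iff)
  have "shift_op m n * mop Q * unshift_op m n \<asymp> y"
    using eqv_shift[OF IP_inf_idem[OF assms(2)] *(3)] assms(4) eqv_sym eqv_trans by blast
  then show "mop (mat_dsum ring_of P Q) \<asymp> x + y"
    unfolding mop_dsum(2)[OF mn(3,4)] using assms orth_shift[OF *(1,2)] by (intro eqv_add)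
qed

text \<open>Block sums become sums of orthogonal representatives, which reduces the laws of V to
  those of addition in \<open>endo\<close>.\<close>

lemma V_add_cl:
  assumes "p \<asymp> x" "q \<asymp> y" "x * y = 0" "y * x = 0"
  shows "V_add ring_of (cl p) (cl q) = cl (x + y)"
proof -
  have xy: "x + y \<in> idem" using assms eqv_idem by (auto intro: idem_add)
  have "V_class ring_of (mat_dsum ring_of P Q) = cl (x + y)" if "P \<in> cl p" "Q \<in> cl q" for P Q
  proof -
    have PQ: "P \<in> IP_inf ring_of" "Q \<in> IP_inf ring_of" "mop P \<asymp> x" "mop Q \<asymp> y"
      using that assms(1,2) eqv_sym eqv_trans unfolding mem_cl by blast+
    show ?thesis
      using cl_dsum[OF PQ assms(3,4)] xy by (simp add: V_class_eq cl_eq_iff IP_inf_idem)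
  qed
  moreover have "cl p \<noteq> {}" "cl q \<noteq> {}"
    using eqv_idem(1)[OF assms(1)] eqv_idem(1)[OF assms(2)] cl_nonempty by blast+
  ultimately show ?thesis by (auto simp: V_add_def)
qed

lemma abelian_semigroup_V: "abelian_semigroup (V_carrier ring_of) (V_add ring_of)"
proof
  fix U V W assume "U \<in> V_carrier ring_of" "V \<in> V_carrier ring_of"
  then obtain p q where pq: "p \<in> idem" "q \<in> idem" "U = cl p" "V = cl q"
    by (auto simp: V_carrier_eq)
  obtain q' where q': "q \<asymp> q'" "p * q' = 0" "q' * p = 0"
    using orth_copy[OF pq(1,2)] .
  have idem: "p + q' \<in> idem" using pq q' eqv_idem by (auto intro: idem_add)
  have UV: "V_add ring_of U V = cl (p + q')"
    unfolding pq using q' pq by (intro V_add_cl) simp_all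
  then show "V_add ring_of U V \<in> V_carrier ring_of"
    using idem by (simp add: V_carrier_eq)
  have "V_add ring_of V U = cl (q' + p)"
    unfolding pq using q' pq by (intro V_add_cl) simp_all
  then show "V_add ring_of U V = V_add ring_of V U" using UV by (simp add: add.commute)
  assume "W \<in> V_carrier ring_of"
  then obtain r where r: "r \<in> idem" "W = cl r" by (auto simp: V_carrier_eq)
  obtain r' where r': "r \<asymp> r'" "(p + q') * r' = 0" "r' * (p + q') = 0"
    using orth_copy[OF idem r(1)] .
  have qq: "q' * q' = q'" using eqv_idem[OF q'(1)] by simp
  \<comment> \<open>From \<open>p * q' = 0 = q' * p\<close> it follows that \<open>p\<close> absorbs
    \<open>p + q'\<close> on both sides, so orthogonality to the sum passes to \<open>p\<close>, and
    then to \<open>q'\<close> by subtraction.\<close>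
  have p0: "p * r' = 0" "r' * p = 0"
  proof -
    have "p * r' = p * ((p + q') * r')" "r' * p = (r' * (p + q')) * p"
      using pq q' by (simp_all add: distrib_left distrib_right mult.assoc[symmetric], simp add: mult.assoc q')
    then show "p * r' = 0" "r' * p = 0" using r' by simp_all
  qed
  then have q0: "q' * r' = 0" "r' * q' = 0"
    using r' by (simp_all add: distrib_left distrib_right)
  have "V_add ring_of (V_add ring_of U V) W = cl (p + q' + r')"
    unfolding UV r using r' idem r by (intro V_add_cl) simp_all
  moreover have "V_add ring_of V W = cl (q' + r')"
    unfolding pq r using q' r' q0 by (intro V_add_cl)
  moreover have "V_add ring_of (cl p) (cl (q' + r')) = cl (p + (q' + r'))"
    using pq q' p0 q0 r' eqv_idem by (intro V_add_cl) (auto intro!: eqv_refl idem_add simp: distrib_left distrib_right)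
  ultimately show "V_add ring_of (V_add ring_of U V) W = V_add ring_of U (V_add ring_of V W)"
    using pq by (simp add: add.assoc)
qed

end

section \<open>Rank factorization of an idempotent matrix over a field\<close>

lemma sum_fun_apply: "(\<Sum>i\<in>A. f i) x = (\<Sum>i\<in>A. f i x)"
  for f :: "'i \<Rightarrow> 'b \<Rightarrow> 'c::ab_group_add"
  by (induction A rule: infinite_finite_induct) simp_all

lemma vector_space_fun: "vector_space (\<lambda>(c::'k::field) (f::'i \<Rightarrow> 'k) i. c * f i)"
  by unfold_locales (auto simp: fun_eq_iff algebra_simps)

text \<open>The columns of \<open>a\<close> are a basis of the column space of \<open>p\<close>; the relation \<open>p * a = a\<close>
  becomes \<open>a * (b * a - 1) = 0\<close>.\<close>

lemma idempotent_rank_factorization: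
  fixes p :: "nat \<Rightarrow> nat \<Rightarrow> 'k::field"
  assumes p: "\<And>i j. i < n \<Longrightarrow> j < n \<Longrightarrow> (\<Sum>l<n. p i l * p l j) = p i j"
  shows "\<exists>(k::nat) a b. (\<forall>i<n. \<forall>j<n. (\<Sum>l<k. a i l * b l j) = p i j) \<and>
    (\<forall>i<k. \<forall>j<k. (\<Sum>l<n. b i l * a l j) = (if i = j then 1 else 0))"
proof -
  interpret V: vector_space "\<lambda>(c::'k) (f::nat \<Rightarrow> 'k) i. c * f i"
    by (rule vector_space_fun)
  \<comment> \<open>Columns are extended by zero to all indices in order to live in a function
    space; rows from \<open>n\<close> on therefore need the separate case \<open>a0\<close>.\<close>
  define col where "col j = (\<lambda>i. if i < n then p i j else 0)" for j
  obtain B where B: "B \<subseteq> col ` {..<n}" "V.independent B" "col ` {..<n} \<subseteq> V.span B"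
    using V.maximal_independent_subset by blast
  have finB: "finite B" using B(1) finite_subset by blast
  obtain w where w: "bij_betw w {0..<card B} B"
    using ex_bij_betw_nat_finite[OF finB] by blast
  define k where "k = card B"
  have w': "bij_betw w {..<k} B" using w by (simp add: k_def atLeast0LessThan)
  have "\<exists>u. col j = (\<Sum>v\<in>B. (\<lambda>i. u v * v i))" if "j < n" for j
    using B(3) that V.span_finite[OF finB] by auto
  then obtain u where u: "\<And>j. j < n \<Longrightarrow> col j = (\<Sum>v\<in>B. (\<lambda>i. u j v * v i))" by metis
  define a where "a i l = w l i" for i l
  define b where "b l j = u j (w l)" for l j
  have reindex: "(\<Sum>v\<in>B. g v) = (\<Sum>l<k. g (w l))" for g :: "(nat \<Rightarrow> 'k) \<Rightarrow> nat \<Rightarrow> 'k"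
    by (rule sum.reindex_bij_betw[OF w', symmetric])
  have ab: "(\<Sum>l<k. a i l * b l j) = p i j" if "i < n" "j < n" for i j
  proof -
    have "p i j = col j i" using that by (simp add: col_def)
    also have "\<dots> = (\<Sum>l<k. u j (w l) * w l i)"
      unfolding u[OF that(2)] reindex sum_fun_apply by simp
    finally show ?thesis by (simp add: a_def b_def mult.commute)
  qed
  have pa: "(\<Sum>l<n. p i l * a l j) = a i j" if "i < n" "j < k" for i j
  proof -
    have "w j \<in> col ` {..<n}" using B(1) w' that by (auto simp: bij_betw_def)
    then obtain m where m: "m < n" "w j = col m" by auto
    have "(\<Sum>l<n. p i l * a l j) = (\<Sum>l<n. p i l * p l m)"
      using m by (intro sum.cong) (auto simp: a_def col_def)
    then show ?thesis using p[OF that(1) m(1)] m that by (simp add: a_def col_def)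
  qed
  have a0: "a i j = 0" if "i \<ge> n" "j < k" for i j
  proof -
    have "w j \<in> col ` {..<n}" using B(1) w' that by (auto simp: bij_betw_def)
    then show ?thesis using that by (auto simp: a_def col_def)
  qed
  have ba: "(\<Sum>l<n. b i l * a l j) = (if i = j then 1 else 0)" if ij: "i < k" "j < k" for i j
  proof -
    \<comment> \<open>A column of b a - 1. As a b a = p a = a, its entries are the coefficients of a
      linear relation between basis vectors, so they vanish.\<close>
    define c where "c m = (\<Sum>l<n. b m l * a l j) - (if m = j then 1 else 0)" for m
    have "(\<Sum>m<k. c m * a r m) = 0" for r
    proof (cases "r < n")
      case True
      have "(\<Sum>m<k. (\<Sum>l<n. b m l * a l j) * a r m) = (\<Sum>m<k. \<Sum>l<n. a r m * b m l * a l j)"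
        by (simp add: sum_distrib_right sum_distrib_left mult_ac)
      also have "\<dots> = (\<Sum>l<n. \<Sum>m<k. a r m * b m l * a l j)" by (rule sum.swap)
      also have "\<dots> = (\<Sum>l<n. p r l * a l j)"
        using True by (intro sum.cong refl) (simp add: sum_distrib_right[symmetric] ab)
      also have "\<dots> = a r j" using True ij by (simp add: pa)
      also have "a r j = (\<Sum>m<k. (if m = j then 1 else 0) * a r m)"
        using ij by (simp add: if_distrib[where f = "\<lambda>x. x * _"] cong: if_cong)
      finally show ?thesis by (simp add: c_def left_diff_distrib sum_subtractf)
    qed (use a0 in simp)
    then have 0: "(\<Sum>m<k. (\<lambda>r. c m * w m r)) = 0"
      by (simp add: fun_eq_iff sum_fun_apply a_def)
    define wi where "wi = the_inv_into {..<k} w"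
    have wi: "wi (w m) = m" if "m < k" for m
      using the_inv_into_f_f[OF bij_betw_imp_inj_on[OF w']] that by (simp add: wi_def)
    have "(\<Sum>v\<in>B. (\<lambda>r. c (wi v) * v r)) = (\<Sum>m<k. (\<lambda>r. c m * w m r))"
      unfolding reindex by (intro sum.cong refl) (simp add: wi)
    then have "c (wi (w i)) = 0"
      using V.independentD[OF B(2) finB subset_refl, of "\<lambda>v. c (wi v)" "w i"] 0 w' ij
      by (auto simp: bij_betw_def)
    then show ?thesis using wi ij by (simp add: c_def)
  qed
  show ?thesis using ab ba by (intro exI[of _ k] exI[of _ a] exI[of _ b]) simp
qed

section \<open>The main argument in algebraic form\<close>

text \<open>The maps \<open>s\<^sub>1\<close>, \<open>s\<^sub>2\<close>, \<open>t\<^sub>1\<close>, \<open>t\<^sub>2\<close> exhibit \<open>e \<oplus> e\<close> as equivalent to an idempotent below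
  \<open>e\<close>: this is condition (i) of the theorem.\<close>

locale ideal_of_idempotent = operator_algebra R
  for R :: "('x::ab_group_add \<Rightarrow> 'x) set" +
  fixes e s\<^sub>1 s\<^sub>2 t\<^sub>1 t\<^sub>2 :: "'x \<Rightarrow> 'x"
  assumes in_R: "e \<in> R" "s\<^sub>1 \<in> R" "s\<^sub>2 \<in> R" "t\<^sub>1 \<in> R" "t\<^sub>2 \<in> R"
    and ee: "e (e x) = e x" and es: "e (s\<^sub>1 x) = s\<^sub>1 x" "e (s\<^sub>2 x) = s\<^sub>2 x"
    and ts: "t\<^sub>1 (s\<^sub>1 x) = e x" "t\<^sub>2 (s\<^sub>2 x) = e x" "t\<^sub>1 (s\<^sub>2 x) = 0" "t\<^sub>2 (s\<^sub>1 x) = 0"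
begin

notation eqv (infix \<open>\<asymp>\<close> 50)

text \<open>In the application \<open>Y\<close> is a retract of \<open>X\<close> and
  \<open>e\<close> projects onto its copy, so these are the operators that factor through
  \<open>Y\<close>, written without a second space.\<close>

definition J where "J = {\<lambda>x. a (e (b x)) | a b. a \<in> R \<and> b \<in> R}"

lemma JI: "a \<in> R \<Longrightarrow> b \<in> R \<Longrightarrow> (\<And>x. f x = a (e (b x))) \<Longrightarrow> f \<in> J"
  unfolding J_def by auto

lemma add_app: "f \<in> R \<Longrightarrow> f (x + y) = f x + f y"
  using additive_R Modules.additive.add by blast

text \<open>Sums are the point: a e b + c e d factors through a single \<open>e\<close>, by means of
  a \<open>t\<^sub>1\<close> + c \<open>t\<^sub>2\<close> on the left and \<open>s\<^sub>1\<close> b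
  + \<open>s\<^sub>2\<close> d on the right.\<close>

lemma op_ideal_J: "op_ideal J"
proof -
  have "J \<subseteq> R" using comp_R[OF _ comp_R[OF in_R(1)]] by (auto simp: J_def)
  moreover have "(\<lambda>_. 0) \<in> J" by (rule JI[of "\<lambda>_. 0" id]) auto
  moreover have "(\<lambda>x. f x + g x) \<in> J" if fg: "f \<in> J" "g \<in> J" for f g
  proof -
    obtain a b c d where abcd: "a \<in> R" "b \<in> R" "c \<in> R" "d \<in> R"
      and f: "f = (\<lambda>x. a (e (b x)))" and g: "g = (\<lambda>x. c (e (d x)))"
      using fg by (auto simp: J_def)
    show ?thesis
    proof (rule JI)
      show "(\<lambda>x. a (t\<^sub>1 x) + c (t\<^sub>2 x)) \<in> R" "(\<lambda>x. s\<^sub>1 (b x) + s\<^sub>2 (d x)) \<in> R"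
        using abcd in_R by (auto intro: add_R comp_R)
      show "f x + g x = (\<lambda>x. a (t\<^sub>1 x) + c (t\<^sub>2 x)) (e ((\<lambda>x. s\<^sub>1 (b x) + s\<^sub>2 (d x)) x))" for x
        using in_R by (simp add: f g add_app es ts)
    qed
  qed
  moreover have "(\<lambda>x. f (g x)) \<in> J" if f: "f \<in> R" and g: "g \<in> J" for f g
  proof -
    obtain a b where "a \<in> R" "b \<in> R" "g = (\<lambda>x. a (e (b x)))" using g by (auto simp: J_def)
    then show ?thesis using comp_R[OF f] by (intro JI[of "\<lambda>x. f (a x)" b]) auto
  qed
  moreover have "(\<lambda>x. f (g x)) \<in> J" if f: "f \<in> J" and g: "g \<in> R" for f g
  proof -
    obtain a b where "a \<in> R" "b \<in> R" "f = (\<lambda>x. a (e (b x)))" using f by (auto simp: J_def)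
    then show ?thesis using comp_R[OF _ g] by (intro JI[of a "\<lambda>x. b (g x)"]) auto
  qed
  ultimately show ?thesis by (simp add: op_ideal_def)
qed

abbreviation e\<^sub>0 where "e\<^sub>0 \<equiv> sng 0 0 e"

lemma sng_M [simp]: "r \<in> R \<Longrightarrow> sng i j r \<in> opmats R"
  by (rule sng_in_opmats[OF op_ideal_R])

lemma sng_eqv:
  assumes "f \<in> R" "\<And>x. f (f x) = f x" shows "sng i i f \<asymp> sng j j f"
proof (rule eqvI)
  show "sng i i f \<in> idem" "sng j j f \<in> idem"
    using assms by (auto intro!: idemI simp: sng_mult)
  show "sng i j f \<in> opmats R" "sng j i f \<in> opmats R" using assms by auto
qed (use assms in \<open>simp_all add: sng_mult\<close>)

text \<open>An ideal matrix is a finite sum of matrix units with coefficients in \<open>J\<close>,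
  each factoring through \<open>e\<^sub>0\<close>. The doubling maps in the corner make such
  products closed under sums, so one copy of \<open>e\<close> suffices for every size.\<close>

lemma factor_J:
  assumes "T \<in> opmats J"
  shows "\<exists>U\<in>opmats R. \<exists>V\<in>opmats R. T = U * e\<^sub>0 * V"
proof -
  define K where "K = {U * e\<^sub>0 * V | U V. U \<in> opmats R \<and> V \<in> opmats R}"
  have K0: "0 \<in> K" unfolding K_def using zero_closed by (metis (mono_tags, lifting) mem_Collect_eq mult_zero_right)
  have Kadd: "x + y \<in> K" if xy: "x \<in> K" "y \<in> K" for x y
  proof -
    obtain U V U' V' where UV: "U \<in> opmats R" "V \<in> opmats R" "U' \<in> opmats R" "V' \<in> opmats R"
      "x = U * e\<^sub>0 * V" "y = U' * e\<^sub>0 * V'"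
      using xy by (auto simp: K_def)
    have 1: "sng 0 0 t\<^sub>1 * (e\<^sub>0 * (sng 0 0 s\<^sub>1 * z)) = e\<^sub>0 * z" "sng 0 0 t\<^sub>2 * (e\<^sub>0 * (sng 0 0 s\<^sub>2 * z)) = e\<^sub>0 * z"
      "sng 0 0 t\<^sub>1 * (e\<^sub>0 * (sng 0 0 s\<^sub>2 * z)) = 0" "sng 0 0 t\<^sub>2 * (e\<^sub>0 * (sng 0 0 s\<^sub>1 * z)) = 0" for z
      by (rule endo_eqI, simp add: app_sng in_R es ts)+
    have "x + y = (U * sng 0 0 t\<^sub>1 + U' * sng 0 0 t\<^sub>2) * e\<^sub>0 * (sng 0 0 s\<^sub>1 * V + sng 0 0 s\<^sub>2 * V')"
      by (simp add: UV(5,6) distrib_left distrib_right mult.assoc 1)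
    then show ?thesis
      unfolding K_def using UV in_R by (blast intro: add_closed mult_closed sng_M)
  qed
  have Ksum: "(\<Sum>i\<in>A. g i) \<in> K" if "\<And>i. i \<in> A \<Longrightarrow> g i \<in> K" for A :: "nat set" and g
    using that by (induction A rule: infinite_finite_induct) (auto intro: K0 Kadd)
  have Ksng: "sng i j r \<in> K" if r: "r \<in> J" for i j r
  proof -
    obtain a b where ab: "a \<in> R" "b \<in> R" "r = (\<lambda>x. a (e (b x)))" using r by (auto simp: J_def)
    then have "sng i j r = sng i 0 a * e\<^sub>0 * sng 0 j b"
      using in_R by (simp add: sng_mult comp_R)
    then show ?thesis unfolding K_def using sng_M ab(1,2) by blast
  qed
  obtain m n a where a: "T = op m n a" "entries_in J m n a"
    using assms by (auto simp: opmats_def)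
  have "T = (\<Sum>i<m. \<Sum>j<n. sng i j (a i j))"
    using a op_sum entries_in_R[OF op_ideal_J] by blast
  also have "\<dots> \<in> K" using a(2) by (intro Ksum Ksng) (auto simp: entries_in_def)
  finally show ?thesis by (auto simp: K_def)
qed

lemma e\<^sub>0_idem [simp]: "e\<^sub>0 \<in> idem"
  using in_R by (auto intro!: idemI simp: sng_mult ee)

end

text \<open>In the application \<open>\<phi>\<close> is the quotient map modulo \<open>J\<close>,
  followed by the identification with the scalars, and \<open>\<sigma>\<close> forms scalar
  multiples of the identity. In \<open>absorb\<close>, the maps \<open>b\<^sub>1\<close>,
  \<open>b\<^sub>2\<close> are the components of an isomorphism from \<open>X\<close> onto the sum
  of \<open>X\<close> and the range of \<open>f\<close>, and \<open>a\<^sub>1\<close>,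
  \<open>a\<^sub>2\<close> those of its inverse.\<close>

locale codim_one_ideal = ideal_of_idempotent R e s\<^sub>1 s\<^sub>2 t\<^sub>1 t\<^sub>2
  for R :: "('x::ab_group_add \<Rightarrow> 'x) set" and e s\<^sub>1 s\<^sub>2 t\<^sub>1 t\<^sub>2 +
  fixes \<phi> :: "('x \<Rightarrow> 'x) \<Rightarrow> 'k::field_char_0" and \<sigma> :: "'k \<Rightarrow> 'x \<Rightarrow> 'x"
  assumes \<sigma>_in_R: "\<sigma> c \<in> R"
    and absorb: "f \<in> R \<Longrightarrow> (\<And>x. f (f x) = f x) \<Longrightarrow> (\<And>x. e (f x) = f x) \<Longrightarrow> (\<And>x. f (e x) = f x) \<Longrightarrow>
      \<exists>a\<^sub>1\<in>R. \<exists>a\<^sub>2\<in>R. \<exists>b\<^sub>1\<in>R. \<exists>b\<^sub>2\<in>R. \<forall>x. a\<^sub>1 (b\<^sub>1 x) + a\<^sub>2 (b\<^sub>2 x) = x \<and>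
        b\<^sub>1 (a\<^sub>1 x) = x \<and> b\<^sub>1 (a\<^sub>2 x) = 0 \<and> b\<^sub>2 (a\<^sub>1 x) = 0 \<and> b\<^sub>2 (a\<^sub>2 x) = f x"
    and \<phi>_add: "f \<in> R \<Longrightarrow> g \<in> R \<Longrightarrow> \<phi> (\<lambda>x. f x + g x) = \<phi> f + \<phi> g"
    and \<phi>_mult: "f \<in> R \<Longrightarrow> g \<in> R \<Longrightarrow> \<phi> (\<lambda>x. f (g x)) = \<phi> f * \<phi> g"
    and \<phi>_id: "\<phi> id = 1"
    and \<sigma>_add: "\<sigma> (c + d) x = \<sigma> c x + \<sigma> d x"
    and \<sigma>_mult: "\<sigma> (c * d) x = \<sigma> c (\<sigma> d x)"
    and \<sigma>_1: "\<sigma> 1 = id"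
    and mod_ideal: "f \<in> R \<Longrightarrow> (\<lambda>x. f x - \<sigma> (\<phi> f) x) \<in> J"
begin

notation eqv (infix \<open>\<asymp>\<close> 50)

section \<open>Absorption of small idempotents by the class of the identity\<close>

abbreviation u where "u \<equiv> unit_op 1"

lemma u_eq: "u = sng 0 0 id"
  by (rule endo_eqI) (simp add: app_unit_op app_sng)

abbreviation vadd (infixl \<open>\<boxplus>\<close> 65) where "vadd \<equiv> V_add ring_of"

text \<open>This returns from infinite matrices to operators on \<open>X\<close>, where
  \<open>absorb\<close> can be applied.\<close>

lemma below_e\<^sub>0:
  assumes "f \<in> idem" "e\<^sub>0 * f = f" "f * e\<^sub>0 = f"
  shows "\<exists>f0\<in>R. f = sng 0 0 f0 \<and> (\<forall>x. f0 (f0 x) = f0 x \<and> e (f0 x) = f0 x \<and> f0 (e x) = f0 x)"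
proof -
  obtain N where "\<forall>n\<ge>N. \<exists>a. f = op n n a \<and> entries_in R n n a"
    using opmats_square[OF idem_in_M[OF assms(1)] op_ideal_R] by blast
  then obtain a where a: "f = op (Suc N) (Suc N) a" "entries_in R (Suc N) (Suc N) a"
    by (meson le_SucI order_refl)
  have a0: "a 0 j \<in> R" if "j < Suc N" for j using a(2) that by (simp add: entries_in_def)
  define f0 where "f0 = (\<lambda>x. e (a 0 0 (e x)))"
  have f0: "f0 \<in> R" unfolding f0_def using comp_R[OF in_R(1) comp_R[OF a0 in_R(1)]] by simp
  have "f = e\<^sub>0 * op (Suc N) (Suc N) a * e\<^sub>0" using assms a by simp
  also have "\<dots> = sng 0 0 f0"
  proof (rule endo_eqI)
    fix v :: "nat \<Rightarrow> 'x" and i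
    have "(\<Sum>j<Suc N. a 0 j (if j = 0 then e (v 0) else 0)) = (\<Sum>j<Suc N. if j = 0 then a 0 0 (e (v 0)) else 0)"
      using a0 by (intro sum.cong) (auto simp: zero_apply)
    then show "app (e\<^sub>0 * op (Suc N) (Suc N) a * e\<^sub>0) v i = app (sng 0 0 f0) v i"
      using a(2) f0 in_R by (simp add: app_op_R app_sng f0_def del: sum.lessThan_Suc)
  qed
  finally have f: "f = sng 0 0 f0" .
  have "f * f = f" using assms(1) by simp
  then have "app (sng 0 0 f0 * sng 0 0 f0) (\<lambda>_. x) 0 = app (sng 0 0 f0) (\<lambda>_. x) 0" for x
    using f by simp
  then have "f0 (f0 x) = f0 x" for x using f0 by (simp add: app_sng)
  then show ?thesis using f0 f by (intro bexI[of _ f0]) (auto simp: f0_def ee)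
qed

text \<open>The maps from \<open>absorb\<close> form a 1 by 2 row and a 2 by 1 column whose two
  products are \<open>u\<close> and the diagonal matrix with entries id and \<open>f0\<close>.
  Moving \<open>f0\<close> to position (1, 1) makes it orthogonal to \<open>u\<close>.\<close>

lemma cl_absorb:
  assumes "f \<in> idem" "e\<^sub>0 * f = f" "f * e\<^sub>0 = f"
  shows "cl f \<boxplus> cl u = cl u"
proof -
  obtain f0 where f0: "f0 \<in> R" "f = sng 0 0 f0" "\<And>x. f0 (f0 x) = f0 x"
    "\<And>x. e (f0 x) = f0 x" "\<And>x. f0 (e x) = f0 x"
    using below_e\<^sub>0[OF assms] by blast
  obtain a\<^sub>1 a\<^sub>2 b\<^sub>1 b\<^sub>2 where ab: "a\<^sub>1 \<in> R" "a\<^sub>2 \<in> R" "b\<^sub>1 \<in> R" "b\<^sub>2 \<in> R"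
    and eq: "\<And>x. a\<^sub>1 (b\<^sub>1 x) + a\<^sub>2 (b\<^sub>2 x) = x" "\<And>x. b\<^sub>1 (a\<^sub>1 x) = x" "\<And>x. b\<^sub>1 (a\<^sub>2 x) = 0"
      "\<And>x. b\<^sub>2 (a\<^sub>1 x) = 0" "\<And>x. b\<^sub>2 (a\<^sub>2 x) = f0 x"
    using absorb[OF f0(1,3,4,5)] by blast
  have ff: "f \<asymp> sng 1 1 f0" unfolding f0(2) using f0 by (intro sng_eqv)
  have orth: "sng 1 1 f0 * u = 0" "u * sng 1 1 f0 = 0"
    unfolding u_eq using f0 by (simp_all add: sng_mult)
  have "sng 1 1 f0 + u \<asymp> u"
  proof (rule eqv_sym, rule eqvI)
    show "sng 1 1 f0 + u \<in> idem" using eqv_idem[OF ff] orth by (intro idem_add) auto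
    show "sng 0 0 a\<^sub>1 + sng 0 1 a\<^sub>2 \<in> opmats R" "sng 0 0 b\<^sub>1 + sng 1 0 b\<^sub>2 \<in> opmats R"
      using ab by auto
    show "u = (sng 0 0 a\<^sub>1 + sng 0 1 a\<^sub>2) * (sng 0 0 b\<^sub>1 + sng 1 0 b\<^sub>2)"
      unfolding u_eq by (rule endo_eqI) (simp add: app_sng ab eq add_app zero_apply)
    show "sng 1 1 f0 + u = (sng 0 0 b\<^sub>1 + sng 1 0 b\<^sub>2) * (sng 0 0 a\<^sub>1 + sng 0 1 a\<^sub>2)"
      unfolding u_eq by (rule endo_eqI) (simp add: app_sng ab eq add_app zero_apply f0(1))
  qed simp
  moreover have "cl f \<boxplus> cl u = cl (sng 1 1 f0 + u)"
    using ff orth by (intro V_add_cl) simp_all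
  ultimately show ?thesis using cl_eq_iff eqv_idem(1) by metis
qed

lemma cl_unit_Suc: "cl (unit_op k) \<boxplus> cl u = cl (unit_op (Suc k))"
  unfolding unit_op_Suc
proof (rule V_add_cl)
  show "u \<asymp> sng k k id" unfolding u_eq by (rule sng_eqv) auto
  show "unit_op k * sng k k id = 0" "sng k k id * unit_op k = 0"
    by (rule endo_eqI, simp add: app_unit_op app_sng)+
qed simp

lemma V_pow_u: "((\<boxplus>) (cl u) ^^ k) (cl u) = cl (unit_op (Suc k))"
proof (induction k)
  case (Suc k)
  interpret abelian_semigroup "V_carrier ring_of" "V_add ring_of" by (rule abelian_semigroup_V)
  show ?case
    using Suc commute[of "cl u" "cl (unit_op (Suc k))"] by (simp add: V_carrier_eq cl_unit_Suc del: One_nat_def)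
qed simp

section \<open>The scalar part of an idempotent matrix\<close>

lemma \<phi>_sum: "(\<And>i. i \<in> A \<Longrightarrow> f i \<in> R) \<Longrightarrow> \<phi> (\<lambda>x. \<Sum>i\<in>A. f i x) = (\<Sum>i\<in>A. \<phi> (f i))"
proof -
  have "\<phi> (\<lambda>_. 0) = 0" using \<phi>_add[of "\<lambda>_. 0" "\<lambda>_. 0"] by simp
  then show "(\<And>i. i \<in> A \<Longrightarrow> f i \<in> R) \<Longrightarrow> \<phi> (\<lambda>x. \<Sum>i\<in>A. f i x) = (\<Sum>i\<in>A. \<phi> (f i))"
    by (induction A rule: infinite_finite_induct) (auto simp: \<phi>_add sum_in_ideal[OF op_ideal_R])
qed

lemma \<phi>_sum_mult:
  assumes "\<And>i. i \<in> A \<Longrightarrow> f i \<in> R" "\<And>i. i \<in> A \<Longrightarrow> h i \<in> R"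
  shows "\<phi> (\<lambda>x. \<Sum>i\<in>A. f i (h i x)) = (\<Sum>i\<in>A. \<phi> (f i) * \<phi> (h i))"
proof -
  have "\<phi> (\<lambda>x. \<Sum>i\<in>A. f i (h i x)) = (\<Sum>i\<in>A. \<phi> (\<lambda>x. f i (h i x)))"
    using comp_R[OF assms] by (intro \<phi>_sum)
  then show ?thesis using assms by (simp add: \<phi>_mult)
qed

lemma \<sigma>_0: "\<sigma> 0 x = 0"
  using \<sigma>_add[of 0 0 x] by simp

lemma \<sigma>_sum_mult: "\<sigma> (\<Sum>i\<in>A. f i * h i) = (\<lambda>x. \<Sum>i\<in>A. \<sigma> (f i) (\<sigma> (h i) x))"
proof
  show "\<sigma> (\<Sum>i\<in>A. f i * h i) x = (\<Sum>i\<in>A. \<sigma> (f i) (\<sigma> (h i) x))" for x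
    by (induction A rule: infinite_finite_induct) (simp_all add: \<sigma>_0 \<sigma>_add \<sigma>_mult)
qed

text \<open>Applying \<open>\<phi>\<close> to the entries gives an idempotent scalar matrix, and
  \<open>\<sigma>\<close> carries its rank factorization back to operators. Because
  \<open>\<sigma>\<close> respects sums and products, \<open>B * A\<close> is exactly the unit,
  whereas \<open>A * B\<close> agrees with \<open>P\<close> only modulo the ideal.\<close>

lemma lift_factorization:
  assumes "P \<in> idem"
  obtains k A B where "A \<in> opmats R" "B \<in> opmats R" "A * unit_op k = A" "unit_op k * B = B"
    "B * A = unit_op k" "P - A * B \<in> opmats J"
proof -
  obtain n a where P: "P = op n n a" "entries_in R n n a"
    using opmats_square[OF idem_in_M[OF assms] op_ideal_R] by blast
  define p where "p i j = \<phi> (a i j)" for i j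
  have aR: "a i j \<in> R" if "i < n" "j < n" for i j using P(2) that by (simp add: entries_in_def)
  have "op n n (\<lambda>i l x. \<Sum>j<n. a i j (a j l x)) = op n n a"
    unfolding op_mult[OF P(2) P(2), symmetric] P(1)[symmetric] by (rule idem_idem[OF assms])
  then have aa: "(\<lambda>x. \<Sum>j<n. a i j (a j l x)) = a i l" if "i < n" "l < n" for i l
    using op_inject[OF _ _ P(2) that] entries_mult[OF P(2) op_ideal_R P(2)] by blast
  have pp: "(\<Sum>l<n. p i l * p l j) = p i j" if "i < n" "j < n" for i j
  proof -
    have "(\<Sum>l<n. p i l * p l j) = \<phi> (\<lambda>x. \<Sum>l<n. a i l (a l j x))"
      unfolding p_def using that by (intro \<phi>_sum_mult[symmetric]) (auto intro: aR)
    then show ?thesis using aa[OF that] by (simp add: p_def)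
  qed
  have "\<exists>(k::nat) \<alpha> \<beta>. (\<forall>i<n. \<forall>j<n. (\<Sum>l<k. \<alpha> i l * \<beta> l j) = p i j) \<and>
      (\<forall>i<k. \<forall>j<k. (\<Sum>l<n. \<beta> i l * \<alpha> l j) = (if i = j then 1 else 0))"
    by (rule idempotent_rank_factorization) (rule pp)
  then obtain k :: nat and \<alpha> \<beta> where \<alpha>\<beta>: "\<forall>i<n. \<forall>j<n. (\<Sum>l<k. \<alpha> i l * \<beta> l j) = p i j"
    and \<beta>\<alpha>: "\<forall>i<k. \<forall>j<k. (\<Sum>l<n. \<beta> i l * \<alpha> l j) = (if i = j then 1 else 0)"
    by (elim exE conjE)
  define A where "A = op n k (\<lambda>i j. \<sigma> (\<alpha> i j))"
  define B where "B = op k n (\<lambda>i j. \<sigma> (\<beta> i j))"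
  have e: "entries_in R m m' (\<lambda>i j. \<sigma> (\<gamma> i j))" for m m' \<gamma>
    using \<sigma>_in_R by (simp add: entries_in_def)
  show ?thesis
  proof (rule that)
    show "A \<in> opmats R" "B \<in> opmats R" "A * unit_op k = A" "unit_op k * B = B"
      using e by (simp_all add: A_def B_def op_in_opmats op_mult_unit unit_mult_op)
    have "B * A = op k k (\<lambda>i j. \<sigma> (\<Sum>l<n. \<beta> i l * \<alpha> l j))"
      unfolding A_def B_def by (simp add: op_mult[OF e e] \<sigma>_sum_mult)
    also have "\<dots> = unit_op k"
      unfolding unit_op_def by (rule op_cong) (simp add: \<beta>\<alpha> \<sigma>_1 \<sigma>_0 fun_eq_iff)
    finally show "B * A = unit_op k" .
    have "A * B = op n n (\<lambda>i j. \<sigma> (\<Sum>l<k. \<alpha> i l * \<beta> l j))"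
      unfolding A_def B_def by (simp add: op_mult[OF e e] \<sigma>_sum_mult)
    also have "\<dots> = op n n (\<lambda>i j. \<sigma> (p i j))"
      by (rule op_cong) (simp add: \<alpha>\<beta>)
    finally have AB: "A * B = op n n (\<lambda>i j. \<sigma> (p i j))" .
    have J: "entries_in J n n (\<lambda>i j x. a i j x - \<sigma> (p i j) x)"
      unfolding entries_in_def
      using mod_ideal[OF aR] by (simp add: p_def)
    have "P - A * B = op n n (\<lambda>i j x. a i j x - \<sigma> (p i j) x)"
      unfolding AB P(1)
      by (rule endo_eqI) (simp add: app_op_R[OF e] app_op_R[OF P(2)] app_op_R[OF entries_in_R[OF op_ideal_J J]] sum_subtractf)
    then show "P - A * B \<in> opmats J" using J by (simp add: op_in_opmats)
  qed
qed

lemma class_plus_unit: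
  assumes P: "P \<in> idem"
  shows "\<exists>k. cl P \<boxplus> cl u = ((\<boxplus>) (cl u) ^^ k) (cl u)"
proof -
  interpret abelian_semigroup "V_carrier ring_of" "V_add ring_of" by (rule abelian_semigroup_V)
  have clS: "cl p \<in> V_carrier ring_of" if "p \<in> idem" for p using that by (simp add: V_carrier_eq)
  note Jc = op_ideal_J
  obtain k A B where AB: "A \<in> opmats R" "B \<in> opmats R" "A * unit_op k = A" "unit_op k * B = B"
    "B * A = unit_op k" and PAB: "P - A * B \<in> opmats J"
    using lift_factorization[OF P] .
  define I where "I = unit_op k"
  \<comment> \<open>Compressing by \<open>P\<close> keeps the discrepancy in the ideal and yields
    the decomposition of \<open>P\<close> required by \<open>eqv_compression\<close>.\<close>
  have "P * (P - A * B) * P \<in> opmats J"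
    using PAB P by (intro opmats_mult_right[OF Jc] opmats_mult_left[OF Jc]) auto
  moreover have "P * (P - A * B) * P = P - P * A * B * P"
    using P by (simp add: left_diff_distrib right_diff_distrib mult.assoc)
  ultimately obtain U V where UV: "U \<in> opmats R" "V \<in> opmats R" "P - P * A * B * P = U * e\<^sub>0 * V"
    using factor_J by metis
  \<comment> \<open>They move \<open>e\<close> between position (0, 0) and position (k, k), the
    first one free of \<open>unit_op k\<close>.\<close>
  define c d where "c = sng k 0 e" and "d = sng 0 k e"
  have cdJ: "c \<in> opmats J" "d \<in> opmats J"
    unfolding c_def d_def using Jc by (auto intro!: sng_in_opmats JI[of id id])
  then have cdR: "c \<in> opmats R" "d \<in> opmats R" using opmats_R[OF Jc] by blast+
  have cd: "c * e\<^sub>0 = c" "e\<^sub>0 * d = d" "d * c = e\<^sub>0" "I * c = 0" "d * I = 0"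
    unfolding c_def d_def I_def
    by (rule endo_eqI, simp add: app_sng in_R app_unit_op ee zero_apply)+
  have PE: "P = P * A * B * P + U * e\<^sub>0 * V" using UV(3) by (simp add: algebra_simps)
  have I: "I \<in> idem" by (simp add: I_def)
  obtain Q where Q: "Q \<in> idem" "P \<asymp> Q" "I + c * d - Q \<in> idem"
    "Q * (I + c * d - Q) = 0" "(I + c * d - Q) * Q = 0"
    and G: "I + c * d - Q = (I - B * P * A) + c * d - B * P * U * d - c * V * P * A - c * V * P * U * d"
    using eqv_compression[OF P AB(1,2) UV(1,2) I cdR AB(3,4)[folded I_def] cd PE] .
  define G where "G = I + c * d - Q"
  \<comment> \<open>Here \<open>B * A = I\<close> must hold exactly.\<close>
  have "I - B * P * A = - (B * (P - A * B) * A)"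
  proof -
    have "B * (A * B) * A = (B * A) * (B * A)" by (simp only: mult.assoc)
    also have "\<dots> = I" unfolding AB(5) using I by (simp add: I_def)
    finally show ?thesis by (simp add: left_diff_distrib right_diff_distrib)
  qed
  moreover have "B * (P - A * B) * A \<in> opmats J"
    using PAB AB by (intro opmats_mult_right[OF Jc] opmats_mult_left[OF Jc]) auto
  ultimately have "I - B * P * A \<in> opmats J" using opmats_uminus[OF Jc] by simp
  \<comment> \<open>Each of the other summands ends in \<open>d\<close> or starts with
    \<open>c\<close>, both of which lie in the ideal.\<close>
  moreover have "c * d \<in> opmats J" "B * P * U * d \<in> opmats J" "c * V * P * U * d \<in> opmats J"
    using P AB(1,2) UV(1,2) cdR by (auto intro!: opmats_mult_left[OF Jc _ cdJ(2)])
  moreover have "c * (V * P * A) \<in> opmats J"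
    using P AB(1,2) UV(1,2) cdR by (auto intro!: opmats_mult_right[OF Jc cdJ(1)])
  then have "c * V * P * A \<in> opmats J" by (simp only: mult.assoc)
  ultimately have "G \<in> opmats J"
    unfolding G_def G using opmats_diff[OF Jc] opmats_add[OF Jc] by presburger
  then obtain U' V' where UV': "U' \<in> opmats R" "V' \<in> opmats R" "G = U' * e\<^sub>0 * V'"
    using factor_J by blast
  have Gi: "G \<in> idem" using Q(3) by (simp add: G_def)
  obtain f where f: "f \<in> idem" "e\<^sub>0 * f = f" "f * e\<^sub>0 = f" "G \<asymp> f"
    using eqv_below[OF Gi e\<^sub>0_idem UV'] .
  have Gu: "cl G \<boxplus> cl u = cl u"
    using cl_absorb[OF f(1-3)] f(4) cl_eq_iff[OF Gi] by metis
  have PG: "cl P \<boxplus> cl G = cl (I + c * d)"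
    using V_add_cl[OF Q(2) eqv_refl[OF Gi]] Q(4,5) by (simp add: G_def)
  have ecd: "e\<^sub>0 \<asymp> c * d"
    using sng_eqv[of e 0 k] in_R ee by (simp add: c_def d_def sng_mult)
  have Ie: "cl I \<boxplus> cl e\<^sub>0 = cl (I + c * d)"
  proof (rule V_add_cl)
    show "I * (c * d) = 0" by (simp add: mult.assoc[symmetric] cd)
    show "c * d * I = 0" by (simp add: mult.assoc cd)
  qed (use I ecd in auto)
  have eu: "cl e\<^sub>0 \<boxplus> cl u = cl u"
    by (rule cl_absorb) (simp_all add: idem_idem[OF e\<^sub>0_idem])
  have S: "cl P \<in> V_carrier ring_of" "cl G \<in> V_carrier ring_of" "cl u \<in> V_carrier ring_of"
    "cl I \<in> V_carrier ring_of" "cl e\<^sub>0 \<in> V_carrier ring_of"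
    using P Gi I by (simp_all add: clS)
  \<comment> \<open>The class of \<open>G\<close> is inserted at no cost, completes \<open>P\<close>
    to the sum of \<open>I\<close> and \<open>e\<close>, and the class of \<open>e\<close> is then
    absorbed in turn.\<close>
  have "cl P \<boxplus> cl u = cl P \<boxplus> (cl G \<boxplus> cl u)" by (simp only: Gu)
  also have "\<dots> = cl I \<boxplus> cl e\<^sub>0 \<boxplus> cl u" using S by (simp only: assoc[symmetric] PG Ie)
  also have "\<dots> = cl I \<boxplus> cl u" using S by (simp only: assoc eu)
  also have "\<dots> = ((\<boxplus>) (cl u) ^^ k) (cl u)" by (simp only: I_def cl_unit_Suc V_pow_u)
  finally show ?thesis by blast
qed

section \<open>The trace of the scalar part as an additive invariant\<close>

definition tr :: "('x \<Rightarrow> 'x) mat \<Rightarrow> 'k"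
  where "tr P = (\<Sum>i<dim_row P. \<phi> (P $$ (i, i)))"

lemma tr_mult:
  assumes "A \<in> mats ring_of m n" "B \<in> mats ring_of n m"
  shows "tr (mat_mult ring_of A B) = (\<Sum>i<m. \<Sum>j<n. \<phi> (A $$ (i, j)) * \<phi> (B $$ (j, i)))"
proof -
  have "\<phi> (mat_mult ring_of A B $$ (i, i)) = (\<Sum>j<n. \<phi> (A $$ (i, j)) * \<phi> (B $$ (j, i)))"
    if i: "i < m" for i
  proof -
    show ?thesis
      unfolding mat_mult_index[OF assms i i] using assms i
      by (intro \<phi>_sum_mult) (auto simp: mats_iff entries_in_def)
  qed
  then show ?thesis
    using mat_mult_mats(1)[OF assms] by (simp add: tr_def mats_iff)
qed

text \<open>Operators do not commute, but their images under \<open>\<phi>\<close> do, whence the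
  usual identity tr(A B) = tr(B A).\<close>

lemma tr_sim0: "(P, Q) \<in> sim0 ring_of \<Longrightarrow> tr P = tr Q"
proof -
  assume "(P, Q) \<in> sim0 ring_of"
  then obtain m n A B where "A \<in> mats ring_of m n" "B \<in> mats ring_of n m"
      "P = mat_mult ring_of A B" "Q = mat_mult ring_of B A"
    by (auto simp: sim0_def)
  then show ?thesis
    by (simp add: tr_mult mult.commute) (rule sum.swap)
qed

lemma tr_dsum:
  assumes "P \<in> mats ring_of m m" "Q \<in> mats ring_of n n"
  shows "tr (mat_dsum ring_of P Q) = tr P + tr Q"
  using assms by (simp add: tr_def mat_dsum_def mats_iff sum_lessThan_add Let_def)

definition V_tr :: "('x \<Rightarrow> 'x) mat set \<Rightarrow> 'k"
  where "V_tr U = tr (SOME P. P \<in> U)"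

lemma V_tr_eq: "P \<in> cl p \<Longrightarrow> V_tr (cl p) = tr P"
  unfolding V_tr_def
proof (rule someI2)
  fix Q assume PQ: "P \<in> cl p" "Q \<in> cl p"
  then have "mop Q \<asymp> mop P" unfolding mem_cl using eqv_sym eqv_trans by blast
  then show "tr Q = tr P" using PQ by (intro tr_sim0) (auto simp: sim0_iff mem_cl)
qed

theorem K0_iso:
  "(\<lambda>n::int. K0_class ring_of (mat_single \<one>\<^bsub>ring_of\<^esub>) [^]\<^bsub>K0 ring_of\<^esub> n)
     \<in> iso integer_group (K0 ring_of)"
proof -
  interpret abelian_semigroup "V_carrier ring_of" "V_add ring_of" by (rule abelian_semigroup_V)
  have single: "mop (mat_single id) = u"
    by (simp add: mop_def mat_single_def unit_op_def, rule endo_eqI)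
      (subst app_op_R, auto simp: entries_in_def app_op_R)
  have "mat_single id \<in> IP ring_of 1"
    unfolding IP_iff single by (auto simp: mats_iff entries_in_def mat_single_def)
  then have sIP: "mat_single id \<in> IP_inf ring_of" by (auto simp: IP_inf_def)
  have su: "mat_single id \<in> cl u" using sIP single by (simp add: mem_cl)
  have cls: "V_class ring_of (mat_single id) = cl u"
    using V_class_eq[OF sIP] single by simp
  have "(\<lambda>n::int. g (cl u) [^]\<^bsub>G\<^esub> n) \<in> iso integer_group G"
  proof (rule int_iso_G[where t = V_tr])
    show "cl u \<in> V_carrier ring_of" by (simp add: V_carrier_eq)
    show "\<exists>n. x \<boxplus> cl u = ((\<boxplus>) (cl u) ^^ n) (cl u)" if "x \<in> V_carrier ring_of" for x
      using that class_plus_unit by (auto simp: V_carrier_eq)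
    show "V_tr (cl u) = 1"
      using V_tr_eq[OF su] by (simp add: tr_def mat_single_def \<phi>_id)
    fix x y assume "x \<in> V_carrier ring_of" "y \<in> V_carrier ring_of"
    then obtain p q where pq: "p \<in> idem" "q \<in> idem" "x = cl p" "y = cl q"
      by (auto simp: V_carrier_eq)
    obtain P where P: "P \<in> cl p" using cl_nonempty[OF pq(1)] by blast
    obtain Q where Q: "Q \<in> cl q" using cl_nonempty[OF pq(2)] by blast
    obtain q' where q': "q \<asymp> q'" "p * q' = 0" "q' * p = 0" using orth_copy[OF pq(1,2)] .
    have PQ: "P \<in> IP_inf ring_of" "Q \<in> IP_inf ring_of" "mop P \<asymp> p" "mop Q \<asymp> q'"
      using P Q q' eqv_sym eqv_trans unfolding mem_cl by blast+
    have "mat_dsum ring_of P Q \<in> cl (p + q')"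
      using cl_dsum[OF PQ q'(2,3)] eqv_sym unfolding mem_cl by blast
    then have "V_tr (x \<boxplus> y) = tr (mat_dsum ring_of P Q)"
      using V_add_cl[OF eqv_refl[OF pq(1)] q'] pq by (simp add: V_tr_eq)
    also have "\<dots> = tr P + tr Q"
      using PQ(1,2) by (meson IP_infE tr_dsum)
    finally show "V_tr (x \<boxplus> y) = V_tr x + V_tr y"
      using pq V_tr_eq[OF P] V_tr_eq[OF Q] by simp
  qed
  then show ?thesis by (simp add: K0_class_def K0_def cls)
qed

end

section \<open>Characters from ideals of codimension one\<close>

context operator_algebra
begin

lemma op_idealD:
  assumes "op_ideal J"
  shows "f \<in> J \<Longrightarrow> f \<in> R" "(\<lambda>_. 0) \<in> J" "f \<in> J \<Longrightarrow> g \<in> J \<Longrightarrow> (\<lambda>x. f x + g x) \<in> J"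
    "f \<in> R \<Longrightarrow> g \<in> J \<Longrightarrow> (\<lambda>x. f (g x)) \<in> J" "f \<in> J \<Longrightarrow> g \<in> R \<Longrightarrow> (\<lambda>x. f (g x)) \<in> J"
  using assms unfolding op_ideal_def by blast+

lemma op_ideal_diff:
  assumes "op_ideal J" "f \<in> J" "g \<in> J" shows "(\<lambda>x. f x - g x) \<in> J"
  using op_idealD(3)[OF assms(1,2) op_idealD(4)[OF assms(1) uminus_R[OF id_R] assms(3)]] by simp

text \<open>The spanning element \<open>b\<close> is arbitrary and has to be exchanged for the
  identity. If id were in \<open>J\<close>, then \<open>J\<close> would be everything and
  coefficients would not be unique; so id is a nonzero multiple of \<open>b\<close> modulo
  \<open>J\<close>. The coefficient of id is then multiplicative because operators commute with
  scalars.\<close>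

lemma character_of_codim_one:
  fixes \<sigma> :: "'k::field \<Rightarrow> 'x \<Rightarrow> 'x"
  assumes J: "op_ideal J"
    and \<sigma>: "\<And>c. \<sigma> c \<in> R" "\<And>c d x. \<sigma> (c + d) x = \<sigma> c x + \<sigma> d x"
      "\<And>c d x. \<sigma> (c * d) x = \<sigma> c (\<sigma> d x)" "\<sigma> 1 = id"
    and central: "\<And>f c x. f \<in> R \<Longrightarrow> f (\<sigma> c x) = \<sigma> c (f x)"
    and b: "b \<in> R" and codim: "\<And>f. f \<in> R \<Longrightarrow> \<exists>!c. (\<lambda>x. f x - \<sigma> c (b x)) \<in> J"
  shows "\<exists>\<phi>. (\<forall>f\<in>R. \<forall>g\<in>R. \<phi> (\<lambda>x. f x + g x) = \<phi> f + \<phi> g) \<and>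
    (\<forall>f\<in>R. \<forall>g\<in>R. \<phi> (\<lambda>x. f (g x)) = \<phi> f * \<phi> g) \<and>
    \<phi> id = 1 \<and> (\<forall>f\<in>R. (\<lambda>x. f x - \<sigma> (\<phi> f) x) \<in> J)"
proof -
  note Jd = op_idealD[OF J]
  have additive_app: "f (x - y) = f x - f y" if "f \<in> R" for f x y
    using additive_R[OF that] by (rule Modules.additive.diff)
  have \<sigma>0: "\<sigma> 0 x = 0" for x using \<sigma>(2)[of 0 0 x] by simp
  have \<sigma>_diff: "\<sigma> (c - d) x = \<sigma> c x - \<sigma> d x" for c d x
    using \<sigma>(2)[of "c - d" d x] by simp
  have id_notin: "id \<notin> J"
  proof
    assume "id \<in> J"
    then have all: "f \<in> J" if "f \<in> R" for f using Jd(4)[OF that] by fastforce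
    have "(\<lambda>x. id x - \<sigma> c (b x)) \<in> J" for c
      using add_R[OF id_R uminus_R[OF comp_R[OF \<sigma>(1) b]]] by (intro all) simp
    then have "(0::'k) = 1" using codim[OF id_R] by blast
    then show False by simp
  qed
  have unit_scalar: "c = 0" if "\<sigma> c \<in> J" for c
  proof (rule ccontr)
    assume "c \<noteq> 0"
    then have "\<sigma> (inverse c) (\<sigma> c x) = x" for x
      unfolding \<sigma>(3)[symmetric] by (simp add: \<sigma>(4))
    then have "id \<in> J" using Jd(4)[OF \<sigma>(1) that, of "inverse c"] by (simp add: id_def)
    then show False using id_notin by simp
  qed
  have uniq: "c = d" if "(\<lambda>x. f x - \<sigma> c x) \<in> J" "(\<lambda>x. f x - \<sigma> d x) \<in> J" for f c d
    using unit_scalar[of "d - c"] op_ideal_diff[OF J that] by (simp add: \<sigma>_diff[abs_def])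
  obtain \<mu> where \<mu>: "(\<lambda>x. id x - \<sigma> \<mu> (b x)) \<in> J" using codim[OF id_R] by blast
  have \<mu>0: "\<mu> \<noteq> 0"
  proof
    assume "\<mu> = 0"
    then show False using \<mu> id_notin by (simp add: \<sigma>0 id_def)
  qed
  have ex: "\<exists>c. (\<lambda>x. f x - \<sigma> c x) \<in> J" if f: "f \<in> R" for f
  proof -
    obtain c where c: "(\<lambda>x. f x - \<sigma> c (b x)) \<in> J" using codim[OF f] by blast
    \<comment> \<open>Subtracting c / \<mu> times the relation between id and \<mu> b from that for
      \<open>f\<close> eliminates \<open>b\<close>.\<close>
    have "\<sigma> (c * inverse \<mu>) (\<sigma> \<mu> x) = \<sigma> c x" for x
    proof -
      have "c * inverse \<mu> * \<mu> = c" using \<mu>0 by (simp add: mult.assoc)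
      then show ?thesis by (metis \<sigma>(3))
    qed
    then have "(\<lambda>x. f x - \<sigma> (c * inverse \<mu>) x) \<in> J"
      using op_ideal_diff[OF J c Jd(4)[OF \<sigma>(1)[of "c * inverse \<mu>"] \<mu>]]
      by (simp add: additive_app[OF \<sigma>(1)])
    then show ?thesis by blast
  qed
  define \<phi> where "\<phi> f = (SOME c. (\<lambda>x. f x - \<sigma> c x) \<in> J)" for f
  have \<phi>: "(\<lambda>x. f x - \<sigma> (\<phi> f) x) \<in> J" if "f \<in> R" for f
    unfolding \<phi>_def using ex[OF that] by (rule someI_ex)
  have eq: "\<phi> f = c" if "f \<in> R" "(\<lambda>x. f x - \<sigma> c x) \<in> J" for f c
    using uniq[OF \<phi>] that by blast
  show ?thesis
  proof (intro exI[of _ \<phi>] conjI ballI)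
    fix f g assume fg: "f \<in> R" "g \<in> R"
    have "(\<lambda>x. (f x + g x) - \<sigma> (\<phi> f + \<phi> g) x) = (\<lambda>x. (f x - \<sigma> (\<phi> f) x) + (g x - \<sigma> (\<phi> g) x))"
      by (simp add: \<sigma>(2) fun_eq_iff algebra_simps)
    then show "\<phi> (\<lambda>x. f x + g x) = \<phi> f + \<phi> g"
      using eq[OF add_R[OF fg]] Jd(3)[OF \<phi>[OF fg(1)] \<phi>[OF fg(2)]] by simp
    have "\<sigma> (\<phi> f * \<phi> g) x = \<sigma> (\<phi> g) (\<sigma> (\<phi> f) x)" for x
      using \<sigma>(3)[of "\<phi> g" "\<phi> f" x] by (simp only: mult.commute)
    then have "(\<lambda>x. f (g x) - \<sigma> (\<phi> f * \<phi> g) x) =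
        (\<lambda>x. f (g x - \<sigma> (\<phi> g) x) + \<sigma> (\<phi> g) (f x - \<sigma> (\<phi> f) x))"
      by (simp add: additive_app[OF fg(1)] additive_app[OF \<sigma>(1)] central[OF fg(1)])
    then show "\<phi> (\<lambda>x. f (g x)) = \<phi> f * \<phi> g"
      using eq[OF comp_R[OF fg]] Jd(3)[OF Jd(4)[OF fg(1) \<phi>[OF fg(2)]] Jd(4)[OF \<sigma>(1) \<phi>[OF fg(1)]]] by simp
  next
    show "\<phi> id = 1" by (rule eq[OF id_R]) (simp add: \<sigma>(4) Jd(2))
  qed (rule \<phi>)
qed

end

section \<open>Operators on Banach spaces\<close>

text \<open>Isomorphisms are given as homeomorphisms, so boundedness must be recovered from
  continuity.\<close>

lemma bounded_linear_of_continuous: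
  fixes f :: "'a::real_normed_vector \<Rightarrow> 'b::real_normed_vector"
  assumes "linear f" "isCont f 0"
  shows "bounded_linear f"
proof -
  interpret linear f by fact
  obtain d where d: "d > 0" "\<And>x. norm x < d \<Longrightarrow> norm (f x) < 1"
    using assms(2)[unfolded continuous_at_eps_delta, rule_format, of 1] zero by (auto simp: dist_norm)
  have "norm (f x) \<le> norm x * (2 / d)" for x
  proof (cases "x = 0")
    case False
    \<comment> \<open>Scales \<open>x\<close> to norm d / 2, safely inside the ball of radius
      d.\<close>
    define r where "r = d / (2 * norm x)"
    have r: "r > 0" using d False by (simp add: r_def)
    have "norm (r *\<^sub>R x) < d" using r d False by (simp add: r_def)
    then have "norm (r *\<^sub>R f x) < 1" using d(2)[of "r *\<^sub>R x"] by (simp only: scale)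
    then have "norm (f x) < 1 / r" using r by (simp add: field_simps)
    then show ?thesis using False d by (simp add: r_def field_simps)
  qed (simp add: zero)
  then show ?thesis by unfold_locales blast
qed

context
  fixes s :: "'k::real_normed_field \<Rightarrow> 'a::banach \<Rightarrow> 'a"
    and t :: "'k \<Rightarrow> 'b::banach \<Rightarrow> 'b"
  assumes s: "banach_over s" and t: "banach_over t"
begin

lemma operatorsI:
  assumes "\<And>x y. f (x + y) = f x + f y" "\<And>c x. f (s c x) = t c (f x)" "continuous_on UNIV f"
  shows "f \<in> operators s t"
proof -
  interpret s: banach_over s by (rule s)
  interpret t: banach_over t by (rule t)
  have "linear f"
    using assms(2)[of "of_real _"] by (intro linearI assms(1)) (simp add: s.scale_of_real t.scale_of_real)
  moreover have "isCont f 0" using assms(3) by (simp add: continuous_on_eq_continuous_at)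
  ultimately have "bounded_linear f" by (rule bounded_linear_of_continuous)
  moreover have "Vector_Spaces.linear s t f"
    using assms(1,2) s.vector_space_axioms t.vector_space_axioms by (simp add: Vector_Spaces.linear_iff)
  ultimately show ?thesis by (simp add: operators_def)
qed

lemma operatorsD:
  assumes "f \<in> operators s t"
  shows "f (x + y) = f x + f y" "f (s c x) = t c (f x)" "continuous_on A f" "f 0 = 0"
  using assms unfolding operators_def Vector_Spaces.linear_iff
  by (auto simp: linear_continuous_on bounded_linear.linear linear_0)

end

lemma operators_comp:
  assumes "banach_over s" "banach_over t" "banach_over u" "f \<in> operators t u" "h \<in> operators s t"
  shows "(\<lambda>x. f (h x)) \<in> operators s u"
  using assms(4,5) operatorsD[OF assms(2,3)] operatorsD[OF assms(1,2)]
  by (intro operatorsI assms continuous_on_compose2[of UNIV f UNIV h]) auto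

lemma continuous_scale:
  assumes "banach_over s" shows "continuous_on A (s c)"
proof -
  interpret banach_over s by fact
  have "bounded_linear (s c)"
  proof
    show "s c (r *\<^sub>R x) = r *\<^sub>R s c x" for r x
      by (simp add: scale_of_real[symmetric] mult.commute)
    show "\<exists>K. \<forall>x. norm (s c x) \<le> norm x * K"
      by (intro exI[of _ "norm c"]) (simp add: norm_scale mult.commute)
  qed (simp add: scale_right_distrib)
  then show ?thesis by (rule linear_continuous_on)
qed

lemma operator_algebra_operators:
  assumes s: "banach_over s" shows "operator_algebra (operators s s)"
proof -
  interpret banach_over s by fact
  note D = operatorsD[OF s s]
  show ?thesis
  proof
    fix f g assume f: "f \<in> operators s s" and g: "g \<in> operators s s"
    show "(\<lambda>x. f x + g x) \<in> operators s s"
      using D[OF f] D[OF g] by (intro operatorsI s continuous_on_add) (auto simp: scale_right_distrib)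
    show "(\<lambda>x. f (g x)) \<in> operators s s" by (rule operators_comp[OF s s s f g])
  next
    fix f assume f: "f \<in> operators s s"
    show "(\<lambda>x. - f x) \<in> operators s s"
      using D[OF f] by (intro operatorsI s continuous_on_minus) auto
  next
    show "f (x + y) = f x + f y" if "f \<in> operators s s" for f x y
      using D(1)[OF that] .
  qed (auto intro!: operatorsI s simp: id_def)
qed

lemma scale_operator:
  assumes s: "banach_over s" shows "s c \<in> operators s s"
proof -
  interpret banach_over s by fact
  show ?thesis
    by (intro operatorsI s continuous_scale[OF s]) (auto simp: scale_right_distrib mult.commute)
qed

text \<open>The values of the inverse \<open>g\<close> off \<open>W\<close> are arbitrary, so its
  continuity and linearity are stated on \<open>W\<close> only; linearity is inherited from
  \<open>f\<close>.\<close>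

lemma isomorphic_to_subspaceD:
  assumes "isomorphic_to_subspace s t W"
  shows "\<exists>f g. (\<forall>x y. f (x + y) = f x + f y) \<and> (\<forall>c x. f (s c x) = t c (f x)) \<and>
    continuous_on UNIV f \<and> continuous_on W g \<and> (\<forall>x. f x \<in> W) \<and> (\<forall>x. g (f x) = x) \<and>
    (\<forall>z\<in>W. f (g z) = z) \<and> (\<forall>z\<in>W. \<forall>z'\<in>W. g (z + z') = g z + g z') \<and>
    (\<forall>z\<in>W. \<forall>c. g (t c z) = s c (g z))"
proof -
  obtain f g where lin: "Vector_Spaces.linear s t f" and hom: "homeomorphism UNIV W f g"
    using assms by (auto simp: isomorphic_to_subspace_def)
  have add: "f (x + y) = f x + f y" and scale: "f (s c x) = t c (f x)" for x y c
    using lin by (simp_all add: Vector_Spaces.linear_iff)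
  have gf: "g (f x) = x" for x using homeomorphism_apply1[OF hom] by simp
  have fg: "f (g z) = z" if "z \<in> W" for z using homeomorphism_apply2[OF hom that] .
  have "g (z + z') = g z + g z'" if "z \<in> W" "z' \<in> W" for z z'
    using gf[of "g z + g z'"] by (simp add: add fg that)
  moreover have "g (t c z) = s c (g z)" if "z \<in> W" for c z
    using gf[of "s c (g z)"] by (simp add: scale fg that)
  moreover have "f x \<in> W" for x using homeomorphism_image1[OF hom] by auto
  ultimately show ?thesis
    using add scale gf fg homeomorphism_cont1[OF hom] homeomorphism_cont2[OF hom]
    by (intro exI[of _ f] exI[of _ g] conjI allI ballI)
qed

text \<open>These are the components of the isomorphism and of its inverse. The map
  \<open>g\<^sub>2\<close> is extended to the whole second space by composing with \<open>P\<close>,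
  which is why the last identity yields \<open>P y\<close>.\<close>

lemma direct_sum_operators:
  assumes s: "banach_over s" and t: "banach_over t"
    and P: "P \<in> operators t t" "\<And>y. P (P y) = P y"
    and iso: "isomorphic_to_subspace s (scale_prod s t) (UNIV \<times> range P)"
  shows "\<exists>h\<^sub>1\<in>operators s s. \<exists>h\<^sub>2\<in>operators s t. \<exists>g\<^sub>1\<in>operators s s. \<exists>g\<^sub>2\<in>operators t s.
    (\<forall>x. g\<^sub>1 (h\<^sub>1 x) + g\<^sub>2 (h\<^sub>2 x) = x \<and> h\<^sub>1 (g\<^sub>1 x) = x \<and> h\<^sub>2 (g\<^sub>1 x) = 0) \<and>
    (\<forall>y. h\<^sub>1 (g\<^sub>2 y) = 0 \<and> h\<^sub>2 (g\<^sub>2 y) = P y)"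
proof -
  interpret s: banach_over s by (rule s)
  interpret t: banach_over t by (rule t)
  note PD = operatorsD[OF t t P(1)]
  let ?W = "UNIV \<times> range P :: ('b \<times> 'c) set"
  obtain f g where fg: "\<forall>x y. f (x + y) = f x + f y" "\<forall>c x. f (s c x) = scale_prod s t c (f x)"
      "continuous_on UNIV f" "continuous_on ?W g" "\<forall>x. f x \<in> ?W" "\<forall>x. g (f x) = x"
      "\<forall>z\<in>?W. f (g z) = z" "\<forall>z\<in>?W. \<forall>z'\<in>?W. g (z + z') = g z + g z'"
      "\<forall>z\<in>?W. \<forall>c. g (scale_prod s t c z) = s c (g z)"
    using isomorphic_to_subspaceD[OF iso] by (elim exE conjE)
  note f = fg(1-3)[rule_format] and g = fg(4) and fW = fg(5)[rule_format]
    and gf = fg(6)[rule_format] and g' = fg(8,9)[rule_format] and fg = fg(7)[rule_format]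
  have W: "(x, P y) \<in> ?W" for x y by simp
  have W0: "(x, 0) \<in> ?W" for x using W[of x 0] unfolding PD(4) .
  have P0: "0 \<in> range P" using W0 by simp
  have fix_W: "P (snd z) = snd z" if "z \<in> ?W" for z using that P(2) by auto
  have sc: "scale_prod s t c (x, y) = (s c x, t c y)" for c x y by (simp add: scale_prod_def)
  have "(\<lambda>x. fst (f x)) \<in> operators s s"
    using f by (intro operatorsI s continuous_on_fst) (simp_all add: scale_prod_def split_beta)
  moreover have "(\<lambda>x. snd (f x)) \<in> operators s t"
    using f by (intro operatorsI s t continuous_on_snd) (simp_all add: scale_prod_def split_beta)
  moreover have "(\<lambda>x. g (x, 0)) \<in> operators s s"
  proof (intro operatorsI s)
    show "g (x + y, 0) = g (x, 0) + g (y, 0)" for x y using g'(1)[OF W0 W0, of x y] by simp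
    show "g (s c x, 0) = s c (g (x, 0))" for c x using g'(2)[OF W0, of c x] by (simp add: sc)
    show "continuous_on UNIV (\<lambda>x. g (x, 0))"
      by (rule continuous_on_compose2[OF g]) (auto intro!: continuous_intros P0)
  qed
  moreover have "(\<lambda>y. g (0, P y)) \<in> operators t s"
  proof (intro operatorsI s t)
    show "g (0, P (x + y)) = g (0, P x) + g (0, P y)" for x y
      using g'(1)[OF W W, of 0 x 0 y] by (simp add: PD(1))
    show "g (0, P (t c x)) = s c (g (0, P x))" for c x
      using g'(2)[OF W, of c 0 x] by (simp add: sc PD(2))
    show "continuous_on UNIV (\<lambda>y. g (0, P y))"
      by (rule continuous_on_compose2[OF g]) (auto intro!: continuous_intros PD(3))
  qed
  moreover have "g (fst (f x), 0) + g (0, P (snd (f x))) = x" for x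
  proof -
    have "g (fst (f x), 0) + g (0, P (snd (f x))) = g ((fst (f x), 0) + (0, P (snd (f x))))"
      by (rule g'(1)[OF W0 W, symmetric])
    also have "\<dots> = x" by (simp add: fix_W[OF fW] gf)
    finally show ?thesis .
  qed
  ultimately show ?thesis
    using fg[OF W0] fg[OF W]
    by - (rule bexI[of _ "\<lambda>x. fst (f x)"], rule bexI[of _ "\<lambda>x. snd (f x)"],
        rule bexI[of _ "\<lambda>x. g (x, 0)"], rule bexI[of _ "\<lambda>y. g (0, P y)"], simp_all)
qed

text \<open>Operator form of condition (i): the \<open>u\<close> maps embed the two summands and
  apply the isomorphism, the \<open>v\<close> maps project by \<open>P\<close>, invert it and take a
  coordinate.\<close>

lemma double_operators:
  assumes t: "banach_over t"
    and iso: "\<exists>W \<in> complemented_subspaces t. isomorphic_to_subspace (scale_prod t t) t W"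
  shows "\<exists>u\<^sub>1\<in>operators t t. \<exists>u\<^sub>2\<in>operators t t. \<exists>v\<^sub>1\<in>operators t t. \<exists>v\<^sub>2\<in>operators t t.
    \<forall>y. v\<^sub>1 (u\<^sub>1 y) = y \<and> v\<^sub>2 (u\<^sub>2 y) = y \<and> v\<^sub>1 (u\<^sub>2 y) = 0 \<and> v\<^sub>2 (u\<^sub>1 y) = 0"
proof -
  interpret t: banach_over t by (rule t)
  obtain P where P: "P \<in> operators t t" "P \<circ> P = P"
    and iso: "isomorphic_to_subspace (scale_prod t t) t (range P)"
    using assms(2) by (auto simp: complemented_subspaces_def)
  note PD = operatorsD[OF t t P(1)]
  obtain f g where fg: "\<forall>x y. f (x + y) = f x + f y" "\<forall>c x. f (scale_prod t t c x) = t c (f x)"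
      "continuous_on UNIV f" "continuous_on (range P) g" "\<forall>x. f x \<in> range P" "\<forall>x. g (f x) = x"
      "\<forall>z\<in>range P. f (g z) = z" "\<forall>z\<in>range P. \<forall>z'\<in>range P. g (z + z') = g z + g z'"
      "\<forall>z\<in>range P. \<forall>c. g (t c z) = scale_prod t t c (g z)"
    using isomorphic_to_subspaceD[OF iso] by (elim exE conjE)
  note f = fg(1-3)[rule_format] and g = fg(4) and fW = fg(5)[rule_format]
    and gf = fg(6)[rule_format] and g' = fg(8,9)[rule_format]
  have fix_W: "P z = z" if "z \<in> range P" for z using that P(2) by (auto simp: fun_eq_iff)
  have sc: "scale_prod t t c (x, y) = (t c x, t c y)" for c x y by (simp add: scale_prod_def)
  have gP: "g (P (f z)) = z" for z using fix_W[OF fW] gf by simp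
  have cont: "continuous_on UNIV (\<lambda>y. g (P y))"
    by (rule continuous_on_compose2[OF g PD(3)]) auto
  show ?thesis
  proof (rule bexI[of _ "\<lambda>y. f (y, 0)"], rule bexI[of _ "\<lambda>y. f (0, y)"],
      rule bexI[of _ "\<lambda>y. fst (g (P y))"], rule bexI[of _ "\<lambda>y. snd (g (P y))"])
    show "(\<lambda>y. f (y, 0)) \<in> operators t t"
    proof (intro operatorsI t)
      show "f (x + y, 0) = f (x, 0) + f (y, 0)" for x y using f(1)[of "(x, 0)" "(y, 0)"] by simp
      show "f (t c x, 0) = t c (f (x, 0))" for c x using f(2)[of c "(x, 0)"] by (simp add: sc)
      show "continuous_on UNIV (\<lambda>y. f (y, 0))"
        by (rule continuous_on_compose2[OF f(3)]) (auto intro!: continuous_intros)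
    qed
    show "(\<lambda>y. f (0, y)) \<in> operators t t"
    proof (intro operatorsI t)
      show "f (0, x + y) = f (0, x) + f (0, y)" for x y using f(1)[of "(0, x)" "(0, y)"] by simp
      show "f (0, t c x) = t c (f (0, x))" for c x using f(2)[of c "(0, x)"] by (simp add: sc)
      show "continuous_on UNIV (\<lambda>y. f (0, y))"
        by (rule continuous_on_compose2[OF f(3)]) (auto intro!: continuous_intros)
    qed
    show "(\<lambda>y. fst (g (P y))) \<in> operators t t" "(\<lambda>y. snd (g (P y))) \<in> operators t t"
      using cont by (auto intro!: operatorsI t continuous_on_fst continuous_on_snd
          simp: PD g' scale_prod_def split_beta)
  qed (simp_all add: gP)
qed

text \<open>For a one-element set, a coefficient function that vanishes off it amounts to its value
  at \<open>b\<close>.\<close>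

lemma codimension_one_unique_scalar:
  assumes "has_codimension (scale_fun s) J V 1"
  shows "\<exists>b\<in>V. \<forall>f\<in>V. \<exists>!c. (\<lambda>x. f x - s c (b x)) \<in> J"
proof -
  obtain b where b: "b \<in> V"
    and codim: "\<And>v. v \<in> V \<Longrightarrow>
      \<exists>!a. (\<forall>d. d \<notin> {b} \<longrightarrow> a d = 0) \<and> v - (\<Sum>d\<in>{b}. scale_fun s (a d) d) \<in> J"
    using assms unfolding has_codimension_def by (auto simp: card_1_singleton_iff)
  have "\<exists>!c. (\<lambda>x. f x - s c (b x)) \<in> J" if f: "f \<in> V" for f
  proof (rule ex_ex1I)
    have eq: "f - (\<Sum>d\<in>{b}. scale_fun s (a d) d) = (\<lambda>x. f x - s (a b) (b x))" for a
      by (simp add: scale_fun_def fun_eq_iff)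
    show "\<exists>c. (\<lambda>x. f x - s c (b x)) \<in> J"
      using codim[OF f] unfolding eq by blast
    fix c d assume cd: "(\<lambda>x. f x - s c (b x)) \<in> J" "(\<lambda>x. f x - s d (b x)) \<in> J"
    let ?P = "\<lambda>a. (\<forall>d. d \<notin> {b} \<longrightarrow> a d = 0) \<and> (\<lambda>x. f x - s (a b) (b x)) \<in> J"
    define A where "A c = (\<lambda>v. if v = b then c else 0)" for c :: 'a
    have A: "?P (A c)" "?P (A d)"
      using cd by (simp_all add: A_def)
    obtain a where a: "\<forall>a'. ?P a' \<longrightarrow> a' = a"
      using codim[OF f, unfolded eq] by (elim ex1E)
    have "A c = A d"
      using a[THEN spec, THEN mp, OF A(1)] a[THEN spec, THEN mp, OF A(2)] by simp
    then show "c = d" by (auto simp: A_def dest: fun_cong[of _ _ b])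
  qed
  then show ?thesis using b by blast
qed

theorem theorem1p1:
  fixes sX :: "'k::real_normed_field \<Rightarrow> 'x::banach \<Rightarrow> 'x"
    and sY :: "'k \<Rightarrow> 'y::banach \<Rightarrow> 'y"
  assumes "banach_over sX" and "banach_over sY"
    and "\<exists>W \<in> complemented_subspaces sY. isomorphic_to_subspace (scale_prod sY sY) sY W"
    and "\<forall>Z \<in> complemented_subspaces sY.
           isomorphic_to_subspace sX (scale_prod sX sY) (UNIV \<times> Z)"
    and "has_codimension (scale_fun sX) (factoring_operators sX sY) (operators sX sX) 1"
  shows "(\<lambda>n::int. K0_class (operator_ring sX) (mat_single \<one>\<^bsub>operator_ring sX\<^esub>)
             [^]\<^bsub>K0 (operator_ring sX)\<^esub> n)
         \<in> iso integer_group (K0 (operator_ring sX))"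
proof -
  note X = assms(1) and Y = assms(2)
  interpret X: banach_over sX by (rule X)
  interpret Y: operator_algebra "operators sY sY" by (rule operator_algebra_operators[OF Y])
  interpret operator_algebra "operators sX sX" by (rule operator_algebra_operators[OF X])
  note XX = operatorsD[OF X X] and XY = operatorsD[OF X Y] and YX = operatorsD[OF Y X]
    and YY = operatorsD[OF Y Y]
  have split: "\<exists>h\<^sub>1\<in>operators sX sX. \<exists>h\<^sub>2\<in>operators sX sY. \<exists>g\<^sub>1\<in>operators sX sX. \<exists>g\<^sub>2\<in>operators sY sX.
      (\<forall>x. g\<^sub>1 (h\<^sub>1 x) + g\<^sub>2 (h\<^sub>2 x) = x \<and> h\<^sub>1 (g\<^sub>1 x) = x \<and> h\<^sub>2 (g\<^sub>1 x) = 0) \<and>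
      (\<forall>y. h\<^sub>1 (g\<^sub>2 y) = 0 \<and> h\<^sub>2 (g\<^sub>2 y) = P y)"
    if P: "P \<in> operators sY sY" "\<And>y. P (P y) = P y" for P
  proof (rule direct_sum_operators[OF X Y P])
    have "P \<circ> P = P" using P(2) by auto
    then have "range P \<in> complemented_subspaces sY"
      using P(1) by (auto simp: complemented_subspaces_def)
    then show "isomorphic_to_subspace sX (scale_prod sX sY) (UNIV \<times> range P)" using assms(4) by blast
  qed
  \<comment> \<open>Taking P = id means Z = Y: inclusion and projection of the second summand make
    \<open>Y\<close> a retract of \<open>X\<close>.\<close>
  obtain p j where pj: "p \<in> operators sX sY" "j \<in> operators sY sX" "\<And>y. p (j y) = y"
    using split[of id] by auto
  obtain u\<^sub>1 u\<^sub>2 v\<^sub>1 v\<^sub>2 where uv: "u\<^sub>1 \<in> operators sY sY" "u\<^sub>2 \<in> operators sY sY"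
    "v\<^sub>1 \<in> operators sY sY" "v\<^sub>2 \<in> operators sY sY"
    "\<forall>y. v\<^sub>1 (u\<^sub>1 y) = y \<and> v\<^sub>2 (u\<^sub>2 y) = y \<and> v\<^sub>1 (u\<^sub>2 y) = 0 \<and> v\<^sub>2 (u\<^sub>1 y) = 0"
    using double_operators[OF Y assms(3)] by blast
  have jp: "(\<lambda>x. j (w (p x))) \<in> operators sX sX" if "w \<in> operators sY sY" for w
    using operators_comp[OF X Y X pj(2) operators_comp[OF X Y Y that pj(1)]] .
  define e where "e x = j (p x)" for x
  \<comment> \<open>Conjugation with \<open>j\<close> and \<open>p\<close> transports the doubling
    maps from \<open>Y\<close> to the copy of \<open>Y\<close> in \<open>X\<close>.\<close>
  interpret ideal_of_idempotent "operators sX sX" e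
    "\<lambda>x. j (u\<^sub>1 (p x))" "\<lambda>x. j (u\<^sub>2 (p x))" "\<lambda>x. j (v\<^sub>1 (p x))" "\<lambda>x. j (v\<^sub>2 (p x))"
    by unfold_locales (use jp[OF uv(1)] jp[OF uv(2)] jp[OF uv(3)] jp[OF uv(4)] jp[OF Y.id_R] in
        \<open>simp_all add: e_def[abs_def] pj(3) uv(5) YX(4)[OF pj(2)]\<close>)
  have J_eq: "J = factoring_operators sX sY"
  proof (intro equalityI subsetI)
    fix f assume "f \<in> J"
    then obtain a b where ab: "a \<in> operators sX sX" "b \<in> operators sX sX" "f = (\<lambda>x. a (e (b x)))"
      by (auto simp: J_def)
    have "f = (\<lambda>y. a (j y)) \<circ> (\<lambda>x. p (b x))" by (simp add: ab(3) e_def o_def)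
    then show "f \<in> factoring_operators sX sY"
      unfolding factoring_operators_def
      using operators_comp[OF Y X X ab(1) pj(2)] operators_comp[OF X X Y pj(1) ab(2)] by blast
  next
    fix f assume "f \<in> factoring_operators sX sY"
    then obtain S T where ST: "S \<in> operators sX sY" "T \<in> operators sY sX" "f = T \<circ> S"
      by (auto simp: factoring_operators_def)
    \<comment> \<open>Since p j = id, T S = (T p) (j p) (j S).\<close>
    show "f \<in> J"
      by (rule JI[OF operators_comp[OF X Y X ST(2) pj(1)] operators_comp[OF X Y X pj(2) ST(1)]])
        (simp add: ST(3) e_def pj(3))
  qed
  obtain b where b: "b \<in> operators sX sX"
    and codim: "\<forall>f\<in>operators sX sX. \<exists>!c. (\<lambda>x. f x - sX c (b x)) \<in> J"
    using codimension_one_unique_scalar[OF assms(5)] unfolding J_eq by blast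
  have "\<exists>\<phi>. (\<forall>f\<in>operators sX sX. \<forall>g\<in>operators sX sX. \<phi> (\<lambda>x. f x + g x) = \<phi> f + \<phi> g) \<and>
    (\<forall>f\<in>operators sX sX. \<forall>g\<in>operators sX sX. \<phi> (\<lambda>x. f (g x)) = \<phi> f * \<phi> g) \<and>
    \<phi> id = 1 \<and> (\<forall>f\<in>operators sX sX. (\<lambda>x. f x - sX (\<phi> f) x) \<in> J)"
    by (rule character_of_codim_one[OF op_ideal_J _ _ _ _ _ b])
      (use codim XX(2) scale_operator[OF X] in \<open>auto simp: X.scale_left_distrib\<close>)
  then obtain \<phi> :: "('x \<Rightarrow> 'x) \<Rightarrow> 'k" where \<phi>:
    "\<forall>f\<in>operators sX sX. \<forall>g\<in>operators sX sX. \<phi> (\<lambda>x. f x + g x) = \<phi> f + \<phi> g"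
    "\<forall>f\<in>operators sX sX. \<forall>g\<in>operators sX sX. \<phi> (\<lambda>x. f (g x)) = \<phi> f * \<phi> g"
    "\<phi> id = 1" "\<forall>f\<in>operators sX sX. (\<lambda>x. f x - sX (\<phi> f) x) \<in> J"
    by (elim exE conjE)
  interpret codim_one_ideal "operators sX sX" e
    "\<lambda>x. j (u\<^sub>1 (p x))" "\<lambda>x. j (u\<^sub>2 (p x))" "\<lambda>x. j (v\<^sub>1 (p x))" "\<lambda>x. j (v\<^sub>2 (p x))" \<phi> sX
  proof
    fix f assume f: "f \<in> operators sX sX" "\<And>x. f (f x) = f x" "\<And>x. e (f x) = f x" "\<And>x. f (e x) = f x"
    \<comment> \<open>The idempotent on \<open>Y\<close> that corresponds to \<open>f\<close>; its
      range is the complemented subspace to which condition (ii) is applied.\<close>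
    have "(\<lambda>y. p (f (j y))) \<in> operators sY sY"
      by (rule operators_comp[OF Y X Y pj(1) operators_comp[OF Y X X f(1) pj(2)]])
    moreover have "p (f (j (p (f (j y))))) = p (f (j y))" for y
      using f(2-4) by (simp add: e_def)
    ultimately obtain h\<^sub>1 h\<^sub>2 g\<^sub>1 g\<^sub>2 where hg: "h\<^sub>1 \<in> operators sX sX" "h\<^sub>2 \<in> operators sX sY"
      "g\<^sub>1 \<in> operators sX sX" "g\<^sub>2 \<in> operators sY sX"
      "\<forall>x. g\<^sub>1 (h\<^sub>1 x) + g\<^sub>2 (h\<^sub>2 x) = x \<and> h\<^sub>1 (g\<^sub>1 x) = x \<and> h\<^sub>2 (g\<^sub>1 x) = 0"
      "\<forall>y. h\<^sub>1 (g\<^sub>2 y) = 0 \<and> h\<^sub>2 (g\<^sub>2 y) = p (f (j y))"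
      using split[of "\<lambda>y. p (f (j y))"] by blast
    have g\<^sub>2p: "(\<lambda>x. g\<^sub>2 (p x)) \<in> operators sX sX" and jh\<^sub>2: "(\<lambda>x. j (h\<^sub>2 x)) \<in> operators sX sX"
      by (rule operators_comp[OF X Y X hg(4) pj(1)], rule operators_comp[OF X Y X pj(2) hg(2)])
    \<comment> \<open>This is e f e = f; it makes the product of j \<open>h\<^sub>2\<close> and
      \<open>g\<^sub>2\<close> p equal to \<open>f\<close>.\<close>
    have "j (p (f (j (p x)))) = f x" for x
      using f(3,4) by (simp add: e_def)
    then show "\<exists>a\<^sub>1\<in>operators sX sX. \<exists>a\<^sub>2\<in>operators sX sX. \<exists>b\<^sub>1\<in>operators sX sX. \<exists>b\<^sub>2\<in>operators sX sX.
        \<forall>x. a\<^sub>1 (b\<^sub>1 x) + a\<^sub>2 (b\<^sub>2 x) = x \<and> b\<^sub>1 (a\<^sub>1 x) = x \<and> b\<^sub>1 (a\<^sub>2 x) = 0 \<and>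
          b\<^sub>2 (a\<^sub>1 x) = 0 \<and> b\<^sub>2 (a\<^sub>2 x) = f x"
      using hg YX(4)[OF pj(2)]
      by - (rule bexI[OF _ hg(3)], rule bexI[OF _ g\<^sub>2p], rule bexI[OF _ hg(1)],
          rule bexI[OF _ jh\<^sub>2], simp add: pj(3))
  qed (use \<phi> scale_operator[OF X] in \<open>auto simp: X.scale_left_distrib\<close>)
  have "operator_ring sX = ring_of" by (simp add: operator_ring_def ring_of_def)
  then show ?thesis using K0_iso by simp
qed

end
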